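(* Let $G\le\mathrm{Sym}_n$. Then there exists a self-dual binary code $C\le\mathbb{F}_2^n$ with $G\le\mathrm{Aut}(C)$ if and only if every self-dual simple $\mathbb{F}_2G$-module $S$ occurs in the $\mathbb{F}_2G$-module $\mathbb{F}_2^n$ (as a composition factor) with even multiplicity.
   Context: $\mathrm{Sym}_n$ acts on $\mathbb{F}_2^n$ by permuting coordinates, making $\mathbb{F}_2^n$ an $\mathbb{F}_2G$-module. A code $C\le \mathbb{F}_2^n$ is self-dual if $C=C^\perp=\{v\mid \sum_i v_ic_i=0\ \forall c\in C\}$. $\mathrm{Aut}(C)=\{\pi\in\mathrm{Sym}_n\mid C\pi=C\}$. For a right $\mathbb{F}_2G$-module $S$, the dual module is $S^*=\mathrm{Hom}_{\mathbb{F}_2}(S,\mathbb{F}_2)$ with $(fg)(s)=f(sg^{-1})$; $S$ is self-dual if $S\cong S^*$. Multiplicity means the number of times $S$ occurs in a composition series. *)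

theory Defs
  imports "HOL-Library.Z2" "HOL-Library.Infinite_Typeclass" "HOL-Algebra.Module" "HOL-Algebra.AbelCoset" "HOL-Algebra.Sym_Groups"
begin

definition F2 :: "bit ring" where
  "F2 = \<lparr>carrier = UNIV, monoid.mult = (*), one = 1, zero = 0, add = (+)\<rparr>"

text \<open>
  A right module over the group algebra of \<open>G\<close> over the two-element field is a vector space over
  that field together with a linear right action of the group \<open>G\<close>. As in \<open>HOL-Algebra\<close>, the module
  record inherits the fields \<open>mult\<close> and \<open>one\<close> from rings; they play no role here.
\<close>

record ('a, 'g) gmodule = "(bit, 'a) module" +
  act :: "'a \<Rightarrow> 'g \<Rightarrow> 'a"  (infixl \<open>\<cdot>\<index>\<close> 70)

locale F2G_module = group G + module F2 M
  for G :: "'g monoid" and M :: "('a, 'g) gmodule" (structure) +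
  assumes act_closed: "\<lbrakk>x \<in> carrier M; g \<in> carrier G\<rbrakk> \<Longrightarrow> x \<cdot> g \<in> carrier M"
    and act_add: "\<lbrakk>x \<in> carrier M; y \<in> carrier M; g \<in> carrier G\<rbrakk>
      \<Longrightarrow> (x \<oplus>\<^bsub>M\<^esub> y) \<cdot> g = x \<cdot> g \<oplus>\<^bsub>M\<^esub> y \<cdot> g"
    and act_smult: "\<lbrakk>a \<in> carrier F2; x \<in> carrier M; g \<in> carrier G\<rbrakk>
      \<Longrightarrow> (a \<odot>\<^bsub>M\<^esub> x) \<cdot> g = a \<odot>\<^bsub>M\<^esub> (x \<cdot> g)"
    and act_one: "x \<in> carrier M \<Longrightarrow> x \<cdot> \<one>\<^bsub>G\<^esub> = x"
    and act_mult: "\<lbrakk>x \<in> carrier M; g \<in> carrier G; h \<in> carrier G\<rbrakk>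
      \<Longrightarrow> x \<cdot> (g \<otimes>\<^bsub>G\<^esub> h) = (x \<cdot> g) \<cdot> h"

definition gsubmodule :: "'g monoid \<Rightarrow> ('a, 'g) gmodule \<Rightarrow> 'a set \<Rightarrow> bool" where
  "gsubmodule G M N \<longleftrightarrow> submodule N F2 M \<and> (\<forall>x\<in>N. \<forall>g\<in>carrier G. x \<cdot>\<^bsub>M\<^esub> g \<in> N)"

definition simple_gmodule :: "'g monoid \<Rightarrow> ('a, 'g) gmodule \<Rightarrow> bool" where
  "simple_gmodule G M \<longleftrightarrow> F2G_module G M \<and> carrier M \<noteq> {\<zero>\<^bsub>M\<^esub>} \<and>
     (\<forall>N. gsubmodule G M N \<longrightarrow> N = {\<zero>\<^bsub>M\<^esub>} \<or> N = carrier M)"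

definition gmodule_hom ::
  "'g monoid \<Rightarrow> ('a, 'g) gmodule \<Rightarrow> ('b, 'g) gmodule \<Rightarrow> ('a \<Rightarrow> 'b) set" where
  "gmodule_hom G M N = {f \<in> carrier M \<rightarrow> carrier N.
     (\<forall>x\<in>carrier M. \<forall>y\<in>carrier M. f (x \<oplus>\<^bsub>M\<^esub> y) = f x \<oplus>\<^bsub>N\<^esub> f y) \<and>
     (\<forall>a\<in>carrier F2. \<forall>x\<in>carrier M. f (a \<odot>\<^bsub>M\<^esub> x) = a \<odot>\<^bsub>N\<^esub> f x) \<and>
     (\<forall>x\<in>carrier M. \<forall>g\<in>carrier G. f (x \<cdot>\<^bsub>M\<^esub> g) = f x \<cdot>\<^bsub>N\<^esub> g)}"

definition gmodule_iso :: "'g monoid \<Rightarrow> ('a, 'g) gmodule \<Rightarrow> ('b, 'g) gmodule \<Rightarrow> bool" where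
  "gmodule_iso G M N \<longleftrightarrow> (\<exists>f \<in> gmodule_hom G M N. bij_betw f (carrier M) (carrier N))"

text \<open>
  The dual consists of the linear forms on \<open>M\<close>, made extensional so that a form is determined by
  its values on the carrier.
\<close>

definition dual_gmodule :: "'g monoid \<Rightarrow> ('a, 'g) gmodule \<Rightarrow> ('a \<Rightarrow> bit, 'g) gmodule" where
  "dual_gmodule G M = \<lparr>
     carrier = {f \<in> extensional (carrier M).
       (\<forall>x\<in>carrier M. \<forall>y\<in>carrier M. f (x \<oplus>\<^bsub>M\<^esub> y) = f x + f y) \<and>
       (\<forall>a\<in>carrier F2. \<forall>x\<in>carrier M. f (a \<odot>\<^bsub>M\<^esub> x) = a * f x)},
     monoid.mult = undefined, one = undefined,
     zero = (\<lambda>x\<in>carrier M. 0),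
     add = (\<lambda>f h. \<lambda>x\<in>carrier M. f x + h x),
     smult = (\<lambda>a f. \<lambda>x\<in>carrier M. a * f x),
     act = (\<lambda>f g. \<lambda>x\<in>carrier M. f (x \<cdot>\<^bsub>M\<^esub> (inv\<^bsub>G\<^esub> g)))\<rparr>"

definition self_dual_gmodule :: "'g monoid \<Rightarrow> ('a, 'g) gmodule \<Rightarrow> bool" where
  "self_dual_gmodule G M \<longleftrightarrow> gmodule_iso G M (dual_gmodule G M)"

text \<open>
  In a quotient, a scalar or a group element sends the coset of \<open>x\<close> to the coset of its image.
  The union over all representatives \<open>x\<close> avoids a choice, as in the library's \<open>rcoset_mult\<close>.
\<close>

definition quotient_gmodule :: "('a, 'g) gmodule \<Rightarrow> 'a set \<Rightarrow> ('a set, 'g) gmodule" where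
  "quotient_gmodule M N = \<lparr>
     carrier = a_rcosets\<^bsub>M\<^esub> N,
     monoid.mult = undefined, one = undefined,
     zero = N,
     add = set_add M,
     smult = (\<lambda>a X. \<Union>x\<in>X. N +>\<^bsub>M\<^esub> (a \<odot>\<^bsub>M\<^esub> x)),
     act = (\<lambda>X g. \<Union>x\<in>X. N +>\<^bsub>M\<^esub> (x \<cdot>\<^bsub>M\<^esub> g))\<rparr>"

definition series_factor :: "('a, 'g) gmodule \<Rightarrow> 'a set list \<Rightarrow> nat \<Rightarrow> ('a set, 'g) gmodule" where
  "series_factor M Ms i = quotient_gmodule (M\<lparr>carrier := Ms ! Suc i\<rparr>) (Ms ! i)"

definition composition_series :: "'g monoid \<Rightarrow> ('a, 'g) gmodule \<Rightarrow> 'a set list \<Rightarrow> bool" where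
  "composition_series G M Ms \<longleftrightarrow>
     Ms \<noteq> [] \<and> hd Ms = {\<zero>\<^bsub>M\<^esub>} \<and> last Ms = carrier M \<and>
     (\<forall>N\<in>set Ms. gsubmodule G M N) \<and>
     (\<forall>i. Suc i < length Ms \<longrightarrow>
        Ms ! i \<subseteq> Ms ! Suc i \<and> simple_gmodule G (series_factor M Ms i))"

text \<open>Well defined for modules with a composition series, by the Jordan--Hoelder theorem.\<close>

definition factor_multiplicity ::
  "'g monoid \<Rightarrow> ('a, 'g) gmodule \<Rightarrow> ('b, 'g) gmodule \<Rightarrow> nat" where
  "factor_multiplicity G M S = (THE m. \<exists>Ms. composition_series G M Ms \<and>
     m = card {i. Suc i < length Ms \<and> gmodule_iso G (series_factor M Ms i) S})"

text \<open>
  Vectors of length \<open>n\<close> are functions on \<open>{1..n}\<close>, the set permuted by \<^term>\<open>sym_group n\<close>,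
  extended by zero. Since multiplication in \<^term>\<open>sym_group n\<close> is \<open>(\<circ>)\<close>, permuting coordinates by
  \<open>v \<mapsto> v \<circ> \<pi>\<close> is a right action.
\<close>

definition F2_space :: "nat \<Rightarrow> (nat \<Rightarrow> bit, nat \<Rightarrow> nat) gmodule" where
  "F2_space n = \<lparr>
     carrier = {v. \<forall>i. i \<notin> {1..n} \<longrightarrow> v i = 0},
     monoid.mult = undefined, one = undefined,
     zero = (\<lambda>i. 0),
     add = (\<lambda>v w i. v i + w i),
     smult = (\<lambda>a v i. a * v i),
     act = (\<lambda>v \<pi>. v \<circ> \<pi>)\<rparr>"

definition dual_code :: "nat \<Rightarrow> (nat \<Rightarrow> bit) set \<Rightarrow> (nat \<Rightarrow> bit) set" where
  "dual_code n C = {v \<in> carrier (F2_space n). \<forall>c\<in>C. (\<Sum>i=1..n. v i * c i) = 0}"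

definition self_dual_code :: "nat \<Rightarrow> (nat \<Rightarrow> bit) set \<Rightarrow> bool" where
  "self_dual_code n C \<longleftrightarrow> submodule C F2 (F2_space n) \<and> C = dual_code n C"

definition Aut_code :: "nat \<Rightarrow> (nat \<Rightarrow> bit) set \<Rightarrow> (nat \<Rightarrow> nat) set" where
  "Aut_code n C = {\<pi> \<in> carrier (sym_group n). (\<lambda>c. c \<cdot>\<^bsub>F2_space n\<^esub> \<pi>) ` C = C}"

text \<open>
  A type variable of class \<^class>\<open>infinite\<close> serves as the universe for the carriers of the simple
  modules quantified over. For a finite group, every simple module is finite, so each
  isomorphism class of simple modules has a representative in every such type (whereas a finite
  type could be too small to contain any).
\<close>

end

theory Submission
  imports Defs "HOL-Library.Function_Algebras"
begin

text \<open>
  If \<open>C\<close> is a self-dual invariant code, the form identifies the factor \<open>A\<^sup>\<bottom>/B\<^sup>\<bottom>\<close> with the dual of \<open>B/A\<close>, so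
  a composition series of \<open>C\<close> is mirrored above \<open>C\<close> and self-dual simple factors occur in pairs.

  Conversely, let \<open>C\<close> be a maximal self-orthogonal invariant code. By maximality \<open>C\<^sup>\<bottom>/C\<close> is anisotropic,
  so every simple submodule of it is self-dual and splits off orthogonally. If \<open>C \<noteq> C\<^sup>\<bottom>\<close>, evenness
  yields two orthogonal submodules \<open>T\<^sub>1/C\<close> and \<open>T\<^sub>2/C\<close> isomorphic to the same simple module \<open>S\<close>. The two
  invariant forms they induce on \<open>S\<close> differ by a self-adjoint automorphism \<open>\<alpha>\<close> of \<open>S\<close>. By Schur's lemma
  in characteristic 2, \<open>\<alpha>\<close> has odd order, so \<open>\<alpha> = \<beta>\<^sup>2\<close> with \<open>\<beta>\<close> a power of \<open>\<alpha>\<close>, and \<open>\<beta>\<close> is an isometry between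
  the two forms. Its graph in \<open>T\<^sub>1 + T\<^sub>2\<close> is self-orthogonal and larger than \<open>C\<close>, a contradiction.
\<close>

section \<open>Modules over the two-element field\<close>

declare add_bit_eq_xor [simp del] mult_bit_eq_and [simp del]

lemma bit_add_self [simp]: "a + a = 0" for a :: bit
  by (cases a) simp_all

lemma F2_simps [simp]:
  "carrier F2 = UNIV" "add F2 = (+)" "zero F2 = 0" "monoid.mult F2 = (*)" "one F2 = 1"
  by (simp_all add: F2_def)

lemma cring_F2: "cring F2"
proof (rule cringI)
  show "abelian_group F2"
  proof (rule abelian_groupI)
    fix x assume "x \<in> carrier F2"
    show "\<exists>y\<in>carrier F2. y \<oplus>\<^bsub>F2\<^esub> x = \<zero>\<^bsub>F2\<^esub>"
      by (rule bexI[of _ x]) simp_all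
  qed (simp_all add: algebra_simps)
  show "comm_monoid F2"
    by (rule comm_monoidI) (simp_all add: algebra_simps)
qed (simp add: algebra_simps)

lemma bit_add_self_fun [simp]: "x + x = 0" for x :: "'i \<Rightarrow> bit"
  by (simp add: fun_eq_iff)

lemma bit_add_self_fun' [simp]: "x + (x + y) = y" for x y :: "'i \<Rightarrow> bit"
  by (metis add.assoc add.left_neutral bit_add_self_fun)

lemma bit_add_self_fun'' [simp]: "x + (y + x) = y" for x y :: "'i \<Rightarrow> bit"
  by (metis add.commute bit_add_self_fun')

lemma comp_add: "(x + y) \<circ> g = (x \<circ> g) + (y \<circ> g)" for x y :: "'i \<Rightarrow> bit"
  by (simp add: fun_eq_iff)

text \<open>Two decompositions of one vector differ by the same vector in the first and in the
  second summand. This makes the map built in \<open>factor_csum_iff\<close> well defined.\<close>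

lemma bit_add_swap_fun:
  fixes a b c d :: "'i \<Rightarrow> bit"
  assumes "a + b = c + d" shows "c + a = d + b"
proof -
  have "c + a = c + (a + b) + b" by (simp add: add.assoc)
  then show ?thesis by (simp add: assms)
qed

lemma bit_add_eq_0: "x + y = 0 \<longleftrightarrow> x = y" for x y :: bit
  by (cases x; cases y) simp_all

text \<open>The only scalars are 0 and 1, so every axiom about scalars follows by cases from
  \<open>smult_0\<close> and \<open>smult_1\<close>, and \<open>add_self\<close> supplies inverses.
  What remains are equations that pass easily to the image of a surjection.\<close>

lemma F2G_moduleI:
  fixes G :: "'g monoid" and M :: "('a, 'g) gmodule" (structure)
  assumes grp: "group G"
    and zero: "\<zero>\<^bsub>M\<^esub> \<in> carrier M"
    and add: "\<And>x y. x \<in> carrier M \<Longrightarrow> y \<in> carrier M \<Longrightarrow> x \<oplus>\<^bsub>M\<^esub> y \<in> carrier M"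
    and assoc: "\<And>x y z. x \<in> carrier M \<Longrightarrow> y \<in> carrier M \<Longrightarrow> z \<in> carrier M \<Longrightarrow>
      (x \<oplus>\<^bsub>M\<^esub> y) \<oplus>\<^bsub>M\<^esub> z = x \<oplus>\<^bsub>M\<^esub> (y \<oplus>\<^bsub>M\<^esub> z)"
    and comm: "\<And>x y. x \<in> carrier M \<Longrightarrow> y \<in> carrier M \<Longrightarrow> x \<oplus>\<^bsub>M\<^esub> y = y \<oplus>\<^bsub>M\<^esub> x"
    and add_zero: "\<And>x. x \<in> carrier M \<Longrightarrow> \<zero>\<^bsub>M\<^esub> \<oplus>\<^bsub>M\<^esub> x = x"
    and add_self: "\<And>x. x \<in> carrier M \<Longrightarrow> x \<oplus>\<^bsub>M\<^esub> x = \<zero>\<^bsub>M\<^esub>"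
    and smult_0: "\<And>x. x \<in> carrier M \<Longrightarrow> 0 \<odot>\<^bsub>M\<^esub> x = \<zero>\<^bsub>M\<^esub>"
    and smult_1: "\<And>x. x \<in> carrier M \<Longrightarrow> 1 \<odot>\<^bsub>M\<^esub> x = x"
    and act: "\<And>x g. x \<in> carrier M \<Longrightarrow> g \<in> carrier G \<Longrightarrow> x \<cdot> g \<in> carrier M"
    and act_zero: "\<And>g. g \<in> carrier G \<Longrightarrow> \<zero>\<^bsub>M\<^esub> \<cdot> g = \<zero>\<^bsub>M\<^esub>"
    and act_add: "\<And>x y g. x \<in> carrier M \<Longrightarrow> y \<in> carrier M \<Longrightarrow> g \<in> carrier G \<Longrightarrow>
      (x \<oplus>\<^bsub>M\<^esub> y) \<cdot> g = x \<cdot> g \<oplus>\<^bsub>M\<^esub> y \<cdot> g"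
    and act_one: "\<And>x. x \<in> carrier M \<Longrightarrow> x \<cdot> \<one>\<^bsub>G\<^esub> = x"
    and act_mult: "\<And>x g h. x \<in> carrier M \<Longrightarrow> g \<in> carrier G \<Longrightarrow> h \<in> carrier G \<Longrightarrow>
      x \<cdot> (g \<otimes>\<^bsub>G\<^esub> h) = (x \<cdot> g) \<cdot> h"
  shows "F2G_module G M"
proof -
  have add_zero': "x \<oplus>\<^bsub>M\<^esub> \<zero>\<^bsub>M\<^esub> = x" if "x \<in> carrier M" for x
    using add_zero comm that zero by metis
  have "abelian_group M"
  proof (rule abelian_groupI)
    fix x assume "x \<in> carrier M"
    then show "\<exists>y\<in>carrier M. y \<oplus> x = \<zero>" using add_self by blast
  qed (use assms in \<open>simp_all\<close>)
  then have "module F2 M"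
  proof (rule moduleI[OF cring_F2], goal_cases)
    case (1 a x) then show ?case by (cases a) (simp_all add: assms)
  next
    case (2 a b x) then show ?case by (cases a; cases b) (simp_all add: assms add_zero')
  next
    case (3 a x y) then show ?case by (cases a) (simp_all add: assms)
  next
    case (4 a b x) then show ?case by (cases a; cases b) (simp_all add: assms)
  next
    case (5 x) then show ?case by (simp add: assms)
  qed
  moreover have "F2G_module_axioms G M"
  proof
    fix a x g assume "a \<in> carrier F2" "x \<in> carrier M" "g \<in> carrier G"
    then show "(a \<odot> x) \<cdot> g = a \<odot> (x \<cdot> g)" by (cases a) (simp_all add: assms)
  qed (simp_all add: assms)
  ultimately show ?thesis
    using grp by (simp add: F2G_module_def)
qed

context F2G_module
begin

lemma smult_bit: "x \<in> carrier M \<Longrightarrow> 0 \<odot>\<^bsub>M\<^esub> x = \<zero>\<^bsub>M\<^esub>" "x \<in> carrier M \<Longrightarrow> 1 \<odot>\<^bsub>M\<^esub> x = x"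
  using smult_l_null[of x] smult_one[of x] by simp_all

lemma add_self: "x \<in> carrier M \<Longrightarrow> x \<oplus>\<^bsub>M\<^esub> x = \<zero>\<^bsub>M\<^esub>"
  using smult_l_distr[of 1 1 x] by (simp add: smult_bit)

lemma add_eq_zero:
  assumes "x \<in> carrier M" "y \<in> carrier M" shows "x \<oplus>\<^bsub>M\<^esub> y = \<zero>\<^bsub>M\<^esub> \<longleftrightarrow> x = y"
  by (metis M.add.m_comm M.minus_equality add_self assms)

lemma act_zero: "g \<in> carrier G \<Longrightarrow> \<zero>\<^bsub>M\<^esub> \<cdot> g = \<zero>\<^bsub>M\<^esub>"
  using act_smult[of 0 "\<zero>\<^bsub>M\<^esub>" g] by (simp add: smult_bit act_closed)

text \<open>Each element is its own negative and the scalars are 0 and 1, so closure under negation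
  and scalars comes for free.\<close>

lemma gsubmodule_iff:
  "gsubmodule G M N \<longleftrightarrow> N \<subseteq> carrier M \<and> \<zero>\<^bsub>M\<^esub> \<in> N \<and> (\<forall>x\<in>N. \<forall>y\<in>N. x \<oplus>\<^bsub>M\<^esub> y \<in> N) \<and>
    (\<forall>x\<in>N. \<forall>g\<in>carrier G. x \<cdot> g \<in> N)" (is "_ \<longleftrightarrow> ?R")
proof
  assume "gsubmodule G M N"
  then have sub: "subgroup N (add_monoid M)" and act: "\<forall>x\<in>N. \<forall>g\<in>carrier G. x \<cdot> g \<in> N"
    by (auto simp: gsubmodule_def submodule_def)
  show ?R
    using subgroup.subset[OF sub] subgroup.one_closed[OF sub] subgroup.m_closed[OF sub] act by auto
next
  assume R: ?R
  have inv: "inv\<^bsub>add_monoid M\<^esub> x = x" if "x \<in> N" for x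
    using that R add_self[of x] M.minus_equality[of x x] by (auto simp: a_inv_def)
  have "subgroup N (add_monoid M)"
    by standard (use R inv in auto)
  moreover have "a \<odot>\<^bsub>M\<^esub> x \<in> N" if "x \<in> N" for a x
    using that R by (cases a) (auto simp: smult_bit subset_iff)
  ultimately show "gsubmodule G M N"
    using R by (auto simp: gsubmodule_def submodule_def submodule_axioms_def)
qed

end

lemma gmodule_hom_zero:
  assumes f: "f \<in> gmodule_hom G M N" and M: "\<zero>\<^bsub>M\<^esub> \<in> carrier M" "0 \<odot>\<^bsub>M\<^esub> \<zero>\<^bsub>M\<^esub> = \<zero>\<^bsub>M\<^esub>"
    and N: "\<And>t. t \<in> carrier N \<Longrightarrow> 0 \<odot>\<^bsub>N\<^esub> t = \<zero>\<^bsub>N\<^esub>"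
  shows "f \<zero>\<^bsub>M\<^esub> = \<zero>\<^bsub>N\<^esub>"
proof -
  have "f (0 \<odot>\<^bsub>M\<^esub> \<zero>\<^bsub>M\<^esub>) = 0 \<odot>\<^bsub>N\<^esub> f \<zero>\<^bsub>M\<^esub>" "f \<zero>\<^bsub>M\<^esub> \<in> carrier N"
    using f M(1) by (auto simp: gmodule_hom_def)
  then show ?thesis using M(2) N by simp
qed

section \<open>Invariant codes and their subquotients\<close>

lemma F2_space_simps [simp]:
  "zero (F2_space n) = 0" "add (F2_space n) = (+)" "act (F2_space n) v p = v \<circ> p"
  "v \<in> carrier (F2_space n) \<longleftrightarrow> (\<forall>i. i \<notin> {1..n} \<longrightarrow> v i = 0)"
  "smult (F2_space n) 0 v = 0" "smult (F2_space n) 1 v = v"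
  by (auto simp: F2_space_def fun_eq_iff)

locale perm_group =
  fixes n :: nat and G :: "(nat \<Rightarrow> nat) set"
  assumes subgroup_G: "subgroup G (sym_group n)"
begin

abbreviation GG :: "(nat \<Rightarrow> nat) monoid" where "GG \<equiv> sym_group n\<lparr>carrier := G\<rparr>"

abbreviation V :: "(nat \<Rightarrow> bit) set" where "V \<equiv> carrier (F2_space n)"

lemma G_permutes: "g \<in> G \<Longrightarrow> g permutes {1..n}"
  using subgroup.subset[OF subgroup_G] by (auto simp: sym_group_carrier)

lemma GG_simps [simp]: "monoid.mult GG = (\<circ>)" "one GG = id"
  by (simp_all add: sym_group_mult sym_group_one)

lemma group_GG: "group GG"
  using subgroup.subgroup_is_group[OF subgroup_G sym_group_is_group] .

lemma G_comp: "g \<in> G \<Longrightarrow> h \<in> G \<Longrightarrow> g \<circ> h \<in> G"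
  using subgroup.m_closed[OF subgroup_G] by (simp add: sym_group_mult)

lemma id_in_G: "id \<in> G"
  using subgroup.one_closed[OF subgroup_G] by (simp add: sym_group_one)

lemma inv_in_G:
  assumes "g \<in> G" shows "inv\<^bsub>GG\<^esub> g \<in> G" "inv\<^bsub>GG\<^esub> g \<circ> g = id" "g \<circ> inv\<^bsub>GG\<^esub> g = id"
  using group.inv_closed[OF group_GG, of g] group.l_inv[OF group_GG, of g]
    group.r_inv[OF group_GG, of g] assms by auto

lemma V_comp: "v \<in> V \<Longrightarrow> g \<in> G \<Longrightarrow> v \<circ> g \<in> V"
  by (metis F2_space_simps(4) G_permutes comp_apply permutes_not_in)

lemma finite_V: "finite V"
proof -
  have "V = {f. \<forall>x. (x \<in> {1..n} \<longrightarrow> f x \<in> {0, 1::bit}) \<and> (x \<notin> {1..n} \<longrightarrow> f x = 0)}"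
    by auto
  then show ?thesis
    using finite_set_of_finite_funs[of "{1..n}" "{0, 1::bit}" 0] by simp
qed

lemma F2G_module_F2_space: "F2G_module GG (F2_space n)"
proof (rule F2G_moduleI[OF group_GG], goal_cases)
  case (9 x g)
  then show ?case using V_comp by (auto simp del: F2_space_simps(4))
qed (auto simp: fun_eq_iff algebra_simps)

text \<open>These are the submodules of \<open>F2_space n\<close>, by \<open>inv_code_iff\<close>.
  Working with sets of functions lets \<open>+\<close> and \<open>\<circ>\<close> replace the record
  operations.\<close>

definition inv_code :: "(nat \<Rightarrow> bit) set \<Rightarrow> bool" where
  "inv_code A \<longleftrightarrow> A \<subseteq> V \<and> 0 \<in> A \<and> (\<forall>x\<in>A. \<forall>y\<in>A. x + y \<in> A) \<and> (\<forall>x\<in>A. \<forall>g\<in>G. x \<circ> g \<in> A)"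

lemma inv_code_iff: "gsubmodule GG (F2_space n) A \<longleftrightarrow> inv_code A"
  by (simp add: F2G_module.gsubmodule_iff[OF F2G_module_F2_space] inv_code_def)

lemma inv_codeD:
  assumes "inv_code A"
  shows "A \<subseteq> V" "0 \<in> A" "\<And>x y. x \<in> A \<Longrightarrow> y \<in> A \<Longrightarrow> x + y \<in> A"
    "\<And>x g. x \<in> A \<Longrightarrow> g \<in> G \<Longrightarrow> x \<circ> g \<in> A" "finite A"
  using assms finite_V finite_subset by (auto simp: inv_code_def)

lemma inv_code_cancel:
  assumes "inv_code A" "x \<in> A" shows "x + y \<in> A \<longleftrightarrow> y \<in> A"
  using inv_codeD(3)[OF assms] inv_codeD(3)[OF assms(1) assms(2), of "x + y"] by auto

text \<open>
  Subquotients \<open>B/A\<close> are handled through surjections from \<open>B\<close> with kernel \<open>A\<close>, so that modules of any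
  carrier type can be compared with them.
\<close>

definition factor_map :: "((nat \<Rightarrow> bit) \<Rightarrow> 'b) \<Rightarrow> (nat \<Rightarrow> bit) set \<Rightarrow> (nat \<Rightarrow> bit) set \<Rightarrow>
    ('b, nat \<Rightarrow> nat) gmodule \<Rightarrow> bool" where
  "factor_map h A B M \<longleftrightarrow> h ` B = carrier M \<and> h 0 = \<zero>\<^bsub>M\<^esub> \<and>
    (\<forall>x\<in>B. \<forall>y\<in>B. h (x + y) = h x \<oplus>\<^bsub>M\<^esub> h y) \<and> (\<forall>x\<in>B. \<forall>g\<in>G. h (x \<circ> g) = h x \<cdot>\<^bsub>M\<^esub> g) \<and>
    (\<forall>s\<in>carrier M. 0 \<odot>\<^bsub>M\<^esub> s = \<zero>\<^bsub>M\<^esub> \<and> 1 \<odot>\<^bsub>M\<^esub> s = s) \<and> {x\<in>B. h x = \<zero>\<^bsub>M\<^esub>} = A"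

definition factor :: "(nat \<Rightarrow> bit) set \<Rightarrow> (nat \<Rightarrow> bit) set \<Rightarrow> ('b, nat \<Rightarrow> nat) gmodule \<Rightarrow> bool" where
  "factor A B M \<longleftrightarrow> (\<exists>h. factor_map h A B M)"

text \<open>The covering relation in the lattice of invariant codes. By
  \<open>simple_factor_iff\<close> it says that \<open>B/A\<close> is simple, whichever module
  represents this quotient.\<close>

definition covers :: "(nat \<Rightarrow> bit) set \<Rightarrow> (nat \<Rightarrow> bit) set \<Rightarrow> bool" where
  "covers A B \<longleftrightarrow> inv_code A \<and> inv_code B \<and> A \<subset> B \<and>
    (\<forall>N. inv_code N \<and> A \<subseteq> N \<and> N \<subseteq> B \<longrightarrow> N = A \<or> N = B)"

lemma factor_mapD:
  assumes "factor_map h A B M"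
  shows "h ` B = carrier M" "h 0 = \<zero>\<^bsub>M\<^esub>" "\<And>x y. x \<in> B \<Longrightarrow> y \<in> B \<Longrightarrow> h (x + y) = h x \<oplus>\<^bsub>M\<^esub> h y"
    "\<And>x g. x \<in> B \<Longrightarrow> g \<in> G \<Longrightarrow> h (x \<circ> g) = h x \<cdot>\<^bsub>M\<^esub> g"
    "\<And>s. s \<in> carrier M \<Longrightarrow> 0 \<odot>\<^bsub>M\<^esub> s = \<zero>\<^bsub>M\<^esub>" "\<And>s. s \<in> carrier M \<Longrightarrow> 1 \<odot>\<^bsub>M\<^esub> s = s"
    "\<And>x. x \<in> B \<Longrightarrow> h x = \<zero>\<^bsub>M\<^esub> \<longleftrightarrow> x \<in> A" "A \<subseteq> B" "\<And>x. x \<in> B \<Longrightarrow> h x \<in> carrier M"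
  using assms unfolding factor_map_def by auto

text \<open>Every element of \<open>M\<close> is \<open>h x\<close> with \<open>x\<close> in
  \<open>B\<close>, and the laws hold for the vectors in \<open>B\<close>; the scalar laws are part
  of \<open>factor_map\<close>.\<close>

lemma F2G_module_factor:
  assumes h: "factor_map h A B M" and B: "inv_code B"
  shows "F2G_module GG M"
proof (rule F2G_moduleI[OF group_GG])
  note h = factor_mapD[OF h] and B = inv_codeD[OF B]
  show "\<zero>\<^bsub>M\<^esub> \<in> carrier M" using h(2,9) B(2) by metis
  show "\<zero>\<^bsub>M\<^esub> \<cdot>\<^bsub>M\<^esub> g = \<zero>\<^bsub>M\<^esub>" if "g \<in> carrier GG" for g
    using h(4)[OF B(2), of g] h(2) that by (simp add: comp_def zero_fun_def)
  fix x assume "x \<in> carrier M"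
  then obtain x' where x: "x' \<in> B" "x = h x'" using h(1) by auto
  show "\<zero>\<^bsub>M\<^esub> \<oplus>\<^bsub>M\<^esub> x = x" using h(3)[OF B(2) x(1)] x h(2) by simp
  show "x \<oplus>\<^bsub>M\<^esub> x = \<zero>\<^bsub>M\<^esub>" using h(3)[OF x(1) x(1)] x h(2) by simp
  show "0 \<odot>\<^bsub>M\<^esub> x = \<zero>\<^bsub>M\<^esub>" "1 \<odot>\<^bsub>M\<^esub> x = x" using h(5,6,9) x by auto
  show "x \<cdot>\<^bsub>M\<^esub> \<one>\<^bsub>GG\<^esub> = x" using h(4)[OF x(1) id_in_G] x by simp
  {
    fix g assume g: "g \<in> carrier GG"
    then have g': "g \<in> G" by simp
    show "x \<cdot>\<^bsub>M\<^esub> g \<in> carrier M" using h(4)[OF x(1) g'] h(9) B(4)[OF x(1) g'] x by metis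
    fix k assume "k \<in> carrier GG"
    then show "x \<cdot>\<^bsub>M\<^esub> (g \<otimes>\<^bsub>GG\<^esub> k) = x \<cdot>\<^bsub>M\<^esub> g \<cdot>\<^bsub>M\<^esub> k"
      using h(4)[OF x(1)] h(4)[OF B(4)[OF x(1) g']] G_comp g' x by (simp add: comp_assoc)
  }
  fix y assume "y \<in> carrier M"
  then obtain y' where y: "y' \<in> B" "y = h y'" using h(1) by auto
  show "x \<oplus>\<^bsub>M\<^esub> y \<in> carrier M" using h(3)[OF x(1) y(1)] h(9) B(3)[OF x(1) y(1)] x y by metis
  show "x \<oplus>\<^bsub>M\<^esub> y = y \<oplus>\<^bsub>M\<^esub> x"
    using h(3)[OF x(1) y(1)] h(3)[OF y(1) x(1)] x y by (simp add: add.commute)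
  {
    fix g assume g: "g \<in> carrier GG"
    then have g': "g \<in> G" by simp
    show "(x \<oplus>\<^bsub>M\<^esub> y) \<cdot>\<^bsub>M\<^esub> g = x \<cdot>\<^bsub>M\<^esub> g \<oplus>\<^bsub>M\<^esub> y \<cdot>\<^bsub>M\<^esub> g"
      using x y B(3,4) g' by (simp add: comp_add flip: h(3,4))
  }
  fix z assume "z \<in> carrier M"
  then obtain z' where z: "z' \<in> B" "z = h z'" using h(1) by auto
  show "x \<oplus>\<^bsub>M\<^esub> y \<oplus>\<^bsub>M\<^esub> z = x \<oplus>\<^bsub>M\<^esub> (y \<oplus>\<^bsub>M\<^esub> z)"
    using x y z B(3) by (simp add: add.assoc flip: h(3))
qed

lemma factor_map_eq:
  assumes h: "factor_map h A B M" and B: "inv_code B" and x: "x \<in> B" "y \<in> B"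
  shows "h x = h y \<longleftrightarrow> x + y \<in> A"
  using F2G_module.add_eq_zero[OF F2G_module_factor[OF h B], of "h x" "h y"] x
    factor_mapD(3,7,9)[OF h] inv_codeD(3)[OF B] by metis

text \<open>The correspondence theorem: image and preimage under \<open>h\<close> are mutually
  inverse between the submodules of \<open>M\<close> and the invariant codes from \<open>A\<close>
  to \<open>B\<close>.\<close>

lemma simple_factor_iff:
  assumes h: "factor_map h A B M" and A: "inv_code A" and B: "inv_code B"
  shows "simple_gmodule GG M \<longleftrightarrow> covers A B"
proof -
  note hD = factor_mapD[OF h] and BD = inv_codeD[OF B] and AD = inv_codeD[OF A]
  interpret M: F2G_module GG M using F2G_module_factor[OF h B] .
  have pre: "inv_code {x\<in>B. h x \<in> N}" if "gsubmodule GG M N" for N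
    using that BD hD(2,3,4) unfolding M.gsubmodule_iff inv_code_def by auto
  have img: "gsubmodule GG M (h ` N)" if N: "inv_code N" "N \<subseteq> B" for N
  proof -
    note ND = inv_codeD[OF N(1)]
    have "h x \<oplus>\<^bsub>M\<^esub> h y \<in> h ` N" if "x \<in> N" "y \<in> N" for x y
      using that hD(3)[of x y] ND(3) N(2) by (metis image_eqI subset_iff)
    moreover have "h x \<cdot>\<^bsub>M\<^esub> g \<in> h ` N" if "x \<in> N" "g \<in> G" for x g
      using that hD(4)[of x g] ND(4) N(2) by (metis image_eqI subset_iff)
    moreover have "\<zero>\<^bsub>M\<^esub> \<in> h ` N" using hD(2) ND(2) by (metis image_eqI)
    ultimately show ?thesis
      unfolding M.gsubmodule_iff using hD(9) N(2) by auto
  qed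
  \<comment> \<open>Within \<open>B\<close>, a code that contains the kernel is a union of fibres of
    \<open>h\<close>, hence the full preimage of its image.\<close>
  have pre_img: "{x\<in>B. h x \<in> h ` N} = N" if N: "inv_code N" "A \<subseteq> N" "N \<subseteq> B" for N
  proof -
    have "x \<in> N" if "x \<in> B" "y \<in> N" "h x = h y" for x y
      using that N factor_map_eq[OF h B, of y x] inv_code_cancel[OF N(1), of y x]
      by (metis subset_iff)
    then show ?thesis using N by auto
  qed
  have img_pre: "h ` {x\<in>B. h x \<in> N} = N" if "N \<subseteq> carrier M" for N
    using that by (auto simp flip: hD(1))
  have zero: "carrier M = {\<zero>\<^bsub>M\<^esub>} \<longleftrightarrow> A = B"
  proof
    assume "carrier M = {\<zero>\<^bsub>M\<^esub>}"
    then have "x \<in> A" if "x \<in> B" for x using hD(7)[OF that] hD(9)[OF that] by simp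
    then show "A = B" using hD(8) by auto
  next
    assume "A = B"
    then have "h ` B = {\<zero>\<^bsub>M\<^esub>}" using hD(7) BD(2) by (auto intro!: image_eqI[of _ _ 0])
    then show "carrier M = {\<zero>\<^bsub>M\<^esub>}" using hD(1) by simp
  qed
  have kerA: "{x\<in>B. h x \<in> {\<zero>\<^bsub>M\<^esub>}} = A" using hD(7,8) by auto
  show ?thesis
  proof
    assume S: "simple_gmodule GG M"
    have "N = A \<or> N = B" if N: "inv_code N" "A \<subseteq> N" "N \<subseteq> B" for N
    proof -
      have "h ` N = {\<zero>\<^bsub>M\<^esub>} \<or> h ` N = carrier M" using S img[OF N(1,3)] by (auto simp: simple_gmodule_def)
      then show ?thesis using pre_img[OF N] kerA hD(9) by auto
    qed
    moreover have "A \<noteq> B" using S zero by (auto simp: simple_gmodule_def)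
    ultimately show "covers A B" using A B hD(8) by (auto simp: covers_def)
  next
    assume C: "covers A B"
    have "N = {\<zero>\<^bsub>M\<^esub>} \<or> N = carrier M" if N: "gsubmodule GG M N" for N
    proof -
      have N': "N \<subseteq> carrier M" "\<zero>\<^bsub>M\<^esub> \<in> N" using N by (auto simp: M.gsubmodule_iff)
      have "A \<subseteq> {x\<in>B. h x \<in> N}" using kerA N' by auto
      then have "{x\<in>B. h x \<in> N} = A \<or> {x\<in>B. h x \<in> N} = B"
        using C pre[OF N] by (auto simp: covers_def)
      then show ?thesis using img_pre[OF N'(1)] img_pre[of "{\<zero>\<^bsub>M\<^esub>}"] kerA hD(1) by auto
    qed
    moreover have "A \<noteq> B" using C by (auto simp: covers_def)
    ultimately show "simple_gmodule GG M"
      using zero M.F2G_module_axioms by (auto simp: simple_gmodule_def)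
  qed
qed

text \<open>In characteristic 2 differences are sums, so \<open>{z. x + z \<in> A}\<close> is the
  coset of \<open>x\<close> modulo \<open>A\<close>.\<close>

lemma coset_eq_iff:
  assumes "inv_code A"
  shows "{z. x + z \<in> A} = {z. y + z \<in> A} \<longleftrightarrow> x + y \<in> A"
proof
  assume "{z. x + z \<in> A} = {z. y + z \<in> A}"
  moreover have "y \<in> {z. y + z \<in> A}" using inv_codeD(2)[OF assms] by simp
  ultimately show "x + y \<in> A" by blast
next
  assume xy: "x + y \<in> A"
  have "x + z \<in> A \<longleftrightarrow> y + z \<in> A" for z
    using inv_code_cancel[OF assms xy, of "y + z"] by (simp add: add.assoc)
  then show "{z. x + z \<in> A} = {z. y + z \<in> A}" by simp
qed

text \<open>The projection \<open>K\<close> to cosets is the required surjection. The unions over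
  representatives in \<open>quotient_gmodule\<close> collapse because all their members are the same
  coset.\<close>

lemma factor_quotient:
  assumes A: "inv_code A" and B: "inv_code B" and AB: "A \<subseteq> B"
  shows "factor A B (quotient_gmodule (F2_space n\<lparr>carrier := B\<rparr>) A)"
proof -
  define M where "M = F2_space n\<lparr>carrier := B\<rparr>"
  define K where "K = (\<lambda>x. {y. x + y \<in> A})"
  note AD = inv_codeD[OF A] and BD = inv_codeD[OF B]
  have coset: "A +>\<^bsub>M\<^esub> x = K x" for x
  proof -
    have "A +>\<^bsub>M\<^esub> x = (\<lambda>a. a + x) ` A"
      by (auto simp: M_def a_r_coset_def r_coset_def)
    also have "\<dots> = K x"
      by (auto simp: K_def add.commute intro!: image_eqI[of _ _ "x + _"])
    finally show ?thesis .
  qed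
  have K_eq: "K x = K y \<longleftrightarrow> x + y \<in> A" for x y
    unfolding K_def by (rule coset_eq_iff[OF A])
  have self: "x \<in> K x" for x using AD(2) by (simp add: K_def)
  have add: "K x <+>\<^bsub>M\<^esub> K y = K (x + y)" for x y
  proof -
    have "K x <+>\<^bsub>M\<^esub> K y = {u + v | u v. u \<in> K x \<and> v \<in> K y}"
      by (auto simp: M_def set_add_def set_mult_def)
    moreover have "u + v \<in> K (x + y)" if "u \<in> K x" "v \<in> K y" for u v
      using AD(3)[of "x + u" "y + v"] that by (simp add: K_def algebra_simps)
    moreover have "\<exists>u v. z = u + v \<and> u \<in> K x \<and> v \<in> K y" if "z \<in> K (x + y)" for z
      using that self[of y] by (intro exI[of _ "z + y"] exI[of _ y]) (auto simp: K_def algebra_simps)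
    ultimately show ?thesis by auto
  qed
  have act: "(\<Union>y\<in>K x. K (y \<circ> g)) = K (x \<circ> g)" if "g \<in> G" for x g
  proof -
    have "K (y \<circ> g) = K (x \<circ> g)" if "y \<in> K x" for y
    proof -
      have "(x + y) \<circ> g \<in> A" using that AD(4) \<open>g \<in> G\<close> by (simp add: K_def)
      then show ?thesis by (simp add: K_eq comp_add add.commute)
    qed
    then show ?thesis using self[of x] by blast
  qed
  have K0: "K 0 = A" by (simp add: K_def)
  have one: "(\<Union>y\<in>K x. K y) = K x" for x
    using self[of x] K_eq[of x] by (auto simp: K_def)
  have zero: "(\<Union>y\<in>K x. K 0) = A" for x
    using self[of x] K0 by auto
  have carrM: "carrier M = B" by (simp add: M_def)
  have carr: "a_rcosets\<^bsub>M\<^esub> A = K ` B"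
    unfolding A_RCOSETS_def RCOSETS_def coset[unfolded a_r_coset_def] by (auto simp: carrM)
  have M: "M \<lparr>carrier := C\<rparr> = F2_space n \<lparr>carrier := C\<rparr>" "smult M = smult (F2_space n)" "act M = act (F2_space n)" for C
    by (simp_all add: M_def)
  have Kker: "K x = A \<longleftrightarrow> x \<in> A" for x
    using K_eq[of x 0] K0 by simp
  have "factor_map K A B (quotient_gmodule M A)"
    unfolding factor_map_def quotient_gmodule_def
    using AB self by (auto simp: coset carr add act one zero Kker K0 M)
  then show ?thesis unfolding factor_def M_def by blast
qed

text \<open>First isomorphism theorem: \<open>h\<close> and \<open>k\<close> have the same kernel,
  so sending \<open>h x\<close> to \<open>k x\<close> is well defined and injective.\<close>

lemma factor_iso:
  assumes "factor A B M" "factor A B N" and B: "inv_code B"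
  shows "gmodule_iso GG M N"
proof -
  obtain h k where h: "factor_map h A B M" and k: "factor_map k A B N"
    using assms by (auto simp: factor_def)
  note hD = factor_mapD[OF h] and kD = factor_mapD[OF k] and BD = inv_codeD[OF B]
  define f where "f = (\<lambda>s. k (inv_into B h s))"
  have f: "f (h x) = k x" if "x \<in> B" for x
  proof -
    have y: "inv_into B h (h x) \<in> B" "h (inv_into B h (h x)) = h x"
      using inv_into_into[OF imageI[OF that], of h] f_inv_into_f[OF imageI[OF that], of h] by auto
    then show ?thesis
      using factor_map_eq[OF h B] factor_map_eq[OF k B] that by (simp add: f_def)
  qed
  have "\<forall>a. \<forall>x\<in>B. f (a \<odot>\<^bsub>M\<^esub> h x) = a \<odot>\<^bsub>N\<^esub> f (h x)"
  proof (intro allI ballI)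
    fix a :: bit and x assume x: "x \<in> B"
    show "f (a \<odot>\<^bsub>M\<^esub> h x) = a \<odot>\<^bsub>N\<^esub> f (h x)"
      using f[OF x] f[OF BD(2)] hD(2,5,6,9) kD(2,5,6,9) x by (cases a) auto
  qed
  then have "f \<in> gmodule_hom GG M N"
    unfolding gmodule_hom_def hD(1)[symmetric]
    using f hD(3,4) kD(3,4,9) BD(3,4) by (auto simp flip: hD(3,4))
  moreover have "inj_on f (carrier M)"
    unfolding hD(1)[symmetric]
    using f factor_map_eq[OF h B] factor_map_eq[OF k B] by (auto simp: inj_on_def)
  moreover have "f ` carrier M = carrier N"
    unfolding hD(1)[symmetric] kD(1)[symmetric] using f by (auto simp: image_image)
  ultimately show ?thesis unfolding gmodule_iso_def bij_betw_def by blast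
qed

lemma factor_gmodule_iso:
  assumes "gmodule_iso GG M N" "factor A B M" and B: "inv_code B" and N: "F2G_module GG N"
  shows "factor A B N"
proof -
  obtain h f where h: "factor_map h A B M" and f: "f \<in> gmodule_hom GG M N"
    and bij: "bij_betw f (carrier M) (carrier N)"
    using assms by (auto simp: factor_def gmodule_iso_def)
  interpret M: F2G_module GG M using F2G_module_factor[OF h B] .
  interpret N: F2G_module GG N by (rule N)
  note hD = factor_mapD[OF h] and BD = inv_codeD[OF B]
  have f0: "f \<zero>\<^bsub>M\<^esub> = \<zero>\<^bsub>N\<^esub>"
    by (rule gmodule_hom_zero[OF f]) (auto simp: M.smult_bit N.smult_bit)
  have ker: "f (h x) = \<zero>\<^bsub>N\<^esub> \<longleftrightarrow> x \<in> A" if "x \<in> B" for x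
    using hD(7)[OF that] hD(9)[OF that] bij_betw_imp_inj_on[OF bij] f0 M.zero_closed
    by (metis inj_on_eq_iff)
  have "factor_map (\<lambda>x. f (h x)) A B N"
    unfolding factor_map_def
  proof (intro conjI ballI)
    show "(\<lambda>x. f (h x)) ` B = carrier N"
      using hD(1) bij_betw_imp_surj_on[OF bij] by (metis image_image)
    show "{x \<in> B. f (h x) = \<zero>\<^bsub>N\<^esub>} = A" using ker hD(8) by auto
  qed (use f hD f0 N.smult_bit in \<open>auto simp: gmodule_hom_def\<close>)
  then show ?thesis by (auto simp: factor_def)
qed

text \<open>The surjection is followed by the inverse of the isomorphism. In
  \<open>factor_perp_iff\<close> the target \<open>N\<close> is a dual module, whose module laws
  come from \<open>F2G_module_factor\<close>.\<close>

lemma factor_gmodule_iso':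
  assumes iso: "gmodule_iso GG M N" and "factor A B N" and B: "inv_code B" and M: "F2G_module GG M"
  shows "factor A B M"
proof -
  obtain h f where h: "factor_map h A B N" and f: "f \<in> gmodule_hom GG M N"
    and bij: "bij_betw f (carrier M) (carrier N)"
    using assms by (auto simp: factor_def gmodule_iso_def)
  interpret N: F2G_module GG N using F2G_module_factor[OF h B] .
  interpret M: F2G_module GG M by (rule M)
  note hD = factor_mapD[OF h] and BD = inv_codeD[OF B]
  define k where "k = (\<lambda>x. inv_into (carrier M) f (h x))"
  have f0: "f \<zero>\<^bsub>M\<^esub> = \<zero>\<^bsub>N\<^esub>"
    by (rule gmodule_hom_zero[OF f]) (auto simp: M.smult_bit N.smult_bit)
  have k: "k x \<in> carrier M" "f (k x) = h x" if "x \<in> B" for x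
    using hD(9)[OF that] bij_betw_imp_surj_on[OF bij] unfolding k_def
    by (auto intro: inv_into_into f_inv_into_f)
  have k_eqI: "k x = s" if "x \<in> B" "s \<in> carrier M" "f s = h x" for x s
    using that k[of x] bij_betw_imp_inj_on[OF bij] by (metis inj_on_eq_iff)
  have k_eq: "k x = s \<longleftrightarrow> f s = h x" if "x \<in> B" "s \<in> carrier M" for x s
    using that k k_eqI by metis
  have "factor_map k A B M"
    unfolding factor_map_def
  proof (intro conjI ballI)
    have "k ` B = inv_into (carrier M) f ` carrier N"
      unfolding hD(1)[symmetric] k_def by (simp add: image_image)
    also have "\<dots> = carrier M"
      using bij_betw_inv_into[OF bij] by (simp add: bij_betw_def)
    finally show "k ` B = carrier M" .
    have "k x = \<zero>\<^bsub>M\<^esub> \<longleftrightarrow> x \<in> A" if "x \<in> B" for x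
      using k_eq[OF that M.zero_closed] f0 hD(7)[OF that] by metis
    then show "{x \<in> B. k x = \<zero>\<^bsub>M\<^esub>} = A" using hD(8) by auto
    show "k 0 = \<zero>\<^bsub>M\<^esub>" using k_eqI[OF BD(2)] f0 hD(2) by simp
    show "k (x + y) = k x \<oplus>\<^bsub>M\<^esub> k y" if "x \<in> B" "y \<in> B" for x y
      using that k f BD(3) hD(3) by (intro k_eqI) (auto simp: gmodule_hom_def)
    show "k (x \<circ> g) = k x \<cdot>\<^bsub>M\<^esub> g" if "x \<in> B" "g \<in> G" for x g
      using that k f BD(4) hD(4) M.act_closed by (intro k_eqI) (auto simp: gmodule_hom_def)
  qed (auto simp: M.smult_bit)
  then show ?thesis by (auto simp: factor_def)
qed

section \<open>Sums of codes and the second isomorphism theorem\<close>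

definition csum :: "(nat \<Rightarrow> bit) set \<Rightarrow> (nat \<Rightarrow> bit) set \<Rightarrow> (nat \<Rightarrow> bit) set" where
  "csum A B = {x + y | x y. x \<in> A \<and> y \<in> B}"

lemma csumI: "x \<in> A \<Longrightarrow> y \<in> B \<Longrightarrow> x + y \<in> csum A B"
  by (auto simp: csum_def)

lemma csum_commute: "csum A B = csum B A"
  unfolding csum_def using add.commute by blast

lemma inv_code_csum:
  assumes "inv_code A" "inv_code B"
  shows "inv_code (csum A B)" "A \<subseteq> csum A B" "B \<subseteq> csum A B"
proof -
  note A = inv_codeD[OF assms(1)] and B = inv_codeD[OF assms(2)]
  have add: "(x + y) + (x' + y') \<in> csum A B" if "x \<in> A" "y \<in> B" "x' \<in> A" "y' \<in> B" for x y x' y'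
    using csumI[OF A(3)[OF that(1,3)] B(3)[OF that(2,4)]] by (simp add: algebra_simps)
  have V: "x + y \<in> V" if "x \<in> A" "y \<in> B" for x y
    using that A(1) B(1) by (auto simp: subset_iff)
  show "inv_code (csum A B)"
    unfolding inv_code_def
  proof (intro conjI ballI)
    show "csum A B \<subseteq> V" using V by (auto simp: csum_def simp del: F2_space_simps(4))
    show "0 \<in> csum A B" using csumI[OF A(2) B(2)] by simp
  next
    fix z w assume "z \<in> csum A B" "w \<in> csum A B"
    then show "z + w \<in> csum A B" unfolding csum_def using add[unfolded csum_def] by blast
  next
    fix z g assume "z \<in> csum A B" "g \<in> G"
    then show "z \<circ> g \<in> csum A B"
      unfolding csum_def using A(4) B(4) by (auto simp: comp_add) blast
  qed
  show "A \<subseteq> csum A B" "B \<subseteq> csum A B"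
    using csumI[of _ A 0 B] csumI[of 0 A _ B] A(2) B(2) by auto
qed

lemma inv_code_inter: "inv_code A \<Longrightarrow> inv_code B \<Longrightarrow> inv_code (A \<inter> B)"
  by (auto simp: inv_code_def)

lemma csum_least: "inv_code C \<Longrightarrow> A \<subseteq> C \<Longrightarrow> B \<subseteq> C \<Longrightarrow> csum A B \<subseteq> C"
  by (auto simp: csum_def intro!: inv_codeD(3))

text \<open>Vectors of \<open>Y\<close> lie in the kernel, so \<open>h\<close> already takes all its
  values on \<open>X\<close>.\<close>

lemma factor_map_restrict:
  assumes "inv_code X" "inv_code Y" "factor_map h Y (csum X Y) M"
  shows "factor_map h (X \<inter> Y) X M"
proof -
  note hD = factor_mapD[OF assms(3)] and sub = inv_code_csum[OF assms(1,2)]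
  have "h (x + y) = h x" if "x \<in> X" "y \<in> Y" for x y
    using that factor_map_eq[OF assms(3) sub(1), of "x + y" x] csumI[OF that] sub(2)
    by (auto simp: algebra_simps)
  then have "h ` csum X Y = h ` X"
    using sub(2) by (auto simp: csum_def)
  then show ?thesis
    using hD sub(2) unfolding factor_map_def by (auto simp: subset_iff)
qed

text \<open>Second isomorphism theorem. One direction is restriction; for the other,
  \<open>h\<close> extends to the sum by ignoring the summand from \<open>Y\<close>.\<close>

lemma factor_csum_iff:
  assumes X: "inv_code X" and Y: "inv_code Y"
  shows "factor Y (csum X Y) M \<longleftrightarrow> factor (X \<inter> Y) X M"
proof
  assume "factor Y (csum X Y) M"
  then show "factor (X \<inter> Y) X M" using factor_map_restrict[OF X Y] by (auto simp: factor_def)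
next
  assume "factor (X \<inter> Y) X M"
  then obtain h where h: "factor_map h (X \<inter> Y) X M" by (auto simp: factor_def)
  note hD = factor_mapD[OF h] and XD = inv_codeD[OF X] and YD = inv_codeD[OF Y]
  \<comment> \<open>The choice picks some \<open>X\<close>-component of \<open>z\<close>. Two such
    components differ by an element of \<open>X \<inter> Y\<close>, where \<open>h\<close>
    vanishes.\<close>
  define k where "k = (\<lambda>z. h (SOME x. x \<in> X \<and> (\<exists>y\<in>Y. z = x + y)))"
  have k: "k (x + y) = h x" if "x \<in> X" "y \<in> Y" for x y
  proof -
    define x' where "x' = (SOME x'. x' \<in> X \<and> (\<exists>y'\<in>Y. x + y = x' + y'))"
    have "x' \<in> X \<and> (\<exists>y'\<in>Y. x + y = x' + y')"
      unfolding x'_def by (rule someI[of _ x]) (use that in auto)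
    then obtain y' where y': "x' \<in> X" "y' \<in> Y" "x + y = x' + y'" by blast
    have "x' + x \<in> X \<inter> Y"
      using bit_add_swap_fun[OF y'(3)] y' that XD(3) YD(3) by (metis IntI)
    then show ?thesis using factor_map_eq[OF h X y'(1) that(1)] by (simp add: k_def x'_def)
  qed
  have sum: "csum X Y = (\<lambda>(x, y). x + y) ` (X \<times> Y)"
    by (auto simp: csum_def)
  have kadd: "k (x + y + (x' + y')) = k (x + y) \<oplus>\<^bsub>M\<^esub> k (x' + y')"
    if "x \<in> X" "y \<in> Y" "x' \<in> X" "y' \<in> Y" for x y x' y'
  proof -
    have "k (x + y + (x' + y')) = k ((x + x') + (y + y'))" by (simp add: algebra_simps)
    then show ?thesis using that k XD(3) YD(3) hD(3) by simp
  qed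
  have "factor_map k Y (csum X Y) M"
    unfolding factor_map_def
  proof (intro conjI)
    show "k ` csum X Y = carrier M"
      unfolding sum hD(1)[symmetric] using k YD(2) by (auto simp: image_iff)
    show "k 0 = \<zero>\<^bsub>M\<^esub>" using k[OF XD(2) YD(2)] hD(2) by simp
    show "\<forall>x\<in>csum X Y. \<forall>y\<in>csum X Y. k (x + y) = k x \<oplus>\<^bsub>M\<^esub> k y"
      using kadd by (auto simp: csum_def)
    show "\<forall>x\<in>csum X Y. \<forall>g\<in>G. k (x \<circ> g) = k x \<cdot>\<^bsub>M\<^esub> g"
      using k hD(4) XD(4) YD(4) by (auto simp: csum_def comp_add)
    show "{x \<in> csum X Y. k x = \<zero>\<^bsub>M\<^esub>} = Y"
      using k hD(7) XD(2) YD(3) csumI[of 0 X _ Y] k[OF XD(2)] hD(2) by (auto simp: csum_def)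
  qed (use hD(5,6) in auto)
  then show "factor Y (csum X Y) M" by (auto simp: factor_def)
qed

text \<open>By \<open>factor_map_restrict\<close> one module represents both quotients, so both are
  simple or neither is.\<close>

lemma covers_csum_iff:
  assumes X: "inv_code X" and Y: "inv_code Y"
  shows "covers Y (csum X Y) \<longleftrightarrow> covers (X \<inter> Y) X"
proof -
  note sub = inv_code_csum[OF X Y]
  obtain h where h: "factor_map h Y (csum X Y) (quotient_gmodule (F2_space n\<lparr>carrier := csum X Y\<rparr>) Y)"
    using factor_quotient[OF Y sub(1) sub(3)] by (auto simp: factor_def)
  show ?thesis
    using simple_factor_iff[OF h Y sub(1)]
      simple_factor_iff[OF factor_map_restrict[OF X Y h] inv_code_inter[OF X Y] X] by simp
qed

section \<open>Covers in the finite lattice of invariant codes\<close>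

lemma coversD:
  assumes "covers A B"
  shows "inv_code A" "inv_code B" "A \<subset> B"
    "\<And>N. inv_code N \<Longrightarrow> A \<subseteq> N \<Longrightarrow> N \<subseteq> B \<Longrightarrow> N = A \<or> N = B"
  using assms by (auto simp: covers_def)

lemma inv_code_zero: "inv_code {0}"
  by (auto simp: inv_code_def fun_eq_iff)

lemma inv_code_V: "inv_code V"
  unfolding inv_code_def using V_comp by (auto simp del: F2_space_simps(4)) auto

lemma finite_inv_codes: "finite {N. inv_code N}"
  by (rule finite_subset[of _ "Pow V"]) (auto simp: inv_code_def finite_V simp del: F2_space_simps(4))

lemma covers_below_ex:
  assumes B: "inv_code B" and A: "inv_code A" "A \<subset> B"
  shows "\<exists>A'. A \<subseteq> A' \<and> covers A' B"
proof -
  let ?F = "{N. inv_code N \<and> A \<subseteq> N \<and> N \<subset> B}"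
  have "finite ?F" "?F \<noteq> {}" using finite_inv_codes A by auto
  from finite_has_maximal[OF this] obtain A'
    where A': "A' \<in> ?F" "\<forall>N\<in>?F. A' \<subseteq> N \<longrightarrow> A' = N" by (rule bexE)
  have "N = A' \<or> N = B" if "inv_code N" "A' \<subseteq> N" "N \<subseteq> B" for N
    using A' that by (metis (mono_tags, lifting) mem_Collect_eq order_trans psubsetI)
  then have "covers A' B" using A' B by (simp add: covers_def)
  then show ?thesis using A'(1) by blast
qed

lemma covers_above_ex:
  assumes B: "inv_code B" and A: "inv_code A" "A \<subset> B"
  shows "\<exists>B'. B' \<subseteq> B \<and> covers A B'"
proof -
  let ?F = "{N. inv_code N \<and> A \<subset> N \<and> N \<subseteq> B}"
  have "finite ?F" "?F \<noteq> {}" using finite_inv_codes A B by auto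
  from finite_has_minimal[OF this] obtain B'
    where B': "B' \<in> ?F" "\<forall>N\<in>?F. N \<subseteq> B' \<longrightarrow> B' = N" by (rule bexE)
  have "N = A \<or> N = B'" if "inv_code N" "A \<subseteq> N" "N \<subseteq> B'" for N
    using B' that by (metis (mono_tags, lifting) mem_Collect_eq order_trans psubsetI)
  then have "covers A B'" using B' A by (simp add: covers_def)
  then show ?thesis using B'(1) by blast
qed

section \<open>Multiplicities of composition factors\<close>

text \<open>Counts the factors isomorphic to \<open>S\<close> along one chain of covers from
  \<open>{0}\<close> up to a code. It is a relation because the count could a priori depend on the
  chain; \<open>series_count_unique\<close> excludes this.\<close>

inductive series_count :: "('b, nat \<Rightarrow> nat) gmodule \<Rightarrow> (nat \<Rightarrow> bit) set \<Rightarrow> nat \<Rightarrow> bool" for S where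
  zero: "series_count S {0} 0"
| step: "series_count S A k \<Longrightarrow> covers A B \<Longrightarrow> series_count S B (k + of_bool (factor A B S))"

lemma series_count_ex:
  assumes "inv_code B" shows "\<exists>k. series_count S B k"
  using assms
proof (induction "card B" arbitrary: B rule: less_induct)
  case less
  show ?case
  proof (cases "B = {0}")
    case True then show ?thesis using series_count.zero by auto
  next
    case False
    then have "{0} \<subset> B" using inv_codeD(2)[OF less.prems] by auto
    then obtain A where A: "covers A B" using covers_below_ex[OF less.prems inv_code_zero] by auto
    then have "card A < card B" using coversD[OF A] inv_codeD(5)[of B] psubset_card_mono by metis
    then obtain k where "series_count S A k" using less.hyps coversD[OF A] by blast
    then show ?thesis using A series_count.step by blast
  qed
qed

lemma covers_zero_False: "covers A {0} \<Longrightarrow> False"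
  using coversD[of A "{0}"] inv_codeD(2)[of A] by auto

text \<open>Jordan-Hoelder. If the chains reach \<open>B\<close> through different codes
  \<open>A1\<close> and \<open>A2\<close>, the second isomorphism theorem matches
  \<open>B/A2\<close> with \<open>A1/?D\<close> and \<open>B/A1\<close> with \<open>A2/?D\<close>,
  so both counts agree with those of chains through the intersection \<open>?D\<close>.\<close>

lemma series_count_unique: "series_count S B k \<Longrightarrow> series_count S B l \<Longrightarrow> k = l"
proof (induction "card B" arbitrary: B k l rule: less_induct)
  case less
  note IH = less.hyps
  have card: "card A < card B" if "covers A B" for A
    using coversD[OF that] inv_codeD(5)[of B] psubset_card_mono by metis
  show ?case
    using less.prems(1)
  proof cases
    case zero
    with less.prems(2) show ?thesis by cases (auto dest: covers_zero_False)
  next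
    case (step A1 k1)
    note A1 = step
    show ?thesis
      using less.prems(2)
    proof cases
      case zero
      with A1 show ?thesis by (auto dest: covers_zero_False)
    next
      case (step A2 k2)
      note A2 = step
      show ?thesis
      proof (cases "A1 = A2")
        case True
        then show ?thesis using IH[OF card[OF A1(3)] A1(2)] A1 A2 by auto
      next
        case False
        note c1 = coversD[OF A1(3)] and c2 = coversD[OF A2(3)]
        let ?D = "A1 \<inter> A2"
        \<comment> \<open>If the sum were smaller than \<open>B\<close>, maximality would make it
          equal to both \<open>A1\<close> and \<open>A2\<close>, which differ.\<close>
        have "csum A1 A2 \<subseteq> B" using csum_least[OF c1(2)] c1(3) c2(3) by auto
        moreover note sum = inv_code_csum[OF c1(1) c2(1)]
        ultimately have "csum A1 A2 = B"
          using c1(4)[OF sum(1,2)] c2(4)[OF sum(1,3)] sum False by metis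
        then have B: "csum A1 A2 = B" "csum A2 A1 = B" by (simp_all add: csum_commute)
        have D: "covers ?D A1" "covers ?D A2" "inv_code ?D"
          using covers_csum_iff[OF c1(1) c2(1)] covers_csum_iff[OF c2(1) c1(1)] A1(3) A2(3)
            inv_code_inter[OF c1(1) c2(1)] B by (simp_all add: Int_commute)
        have f: "factor A2 B S \<longleftrightarrow> factor ?D A1 S" "factor A1 B S \<longleftrightarrow> factor ?D A2 S"
          using factor_csum_iff[OF c1(1) c2(1), of S] factor_csum_iff[OF c2(1) c1(1), of S]
          by (simp_all add: B Int_commute)
        \<comment> \<open>A chain for \<open>?D\<close> extends to \<open>A1\<close> and to
          \<open>A2\<close>; the induction hypothesis compares \<open>k1\<close> and
          \<open>k2\<close> with these extensions.\<close>
        obtain d where d: "series_count S ?D d" using series_count_ex[OF D(3)] by blast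
        have "k1 = d + of_bool (factor ?D A1 S)"
          by (rule IH[OF card[OF A1(3)] A1(2)]) (rule series_count.step[OF d D(1)])
        moreover have "k2 = d + of_bool (factor ?D A2 S)"
          by (rule IH[OF card[OF A2(3)] A2(2)]) (rule series_count.step[OF d D(2)])
        ultimately show ?thesis using A1(1) A2(1) f by simp
      qed
    qed
  qed
qed

definition mult_in :: "('b, nat \<Rightarrow> nat) gmodule \<Rightarrow> (nat \<Rightarrow> bit) set \<Rightarrow> nat" where
  "mult_in S B = (THE k. series_count S B k)"

lemma mult_in_eqI: "series_count S B k \<Longrightarrow> mult_in S B = k"
  unfolding mult_in_def using series_count_unique by blast

lemma mult_in_zero: "mult_in S {0} = 0"
  by (rule mult_in_eqI) (rule series_count.zero)

lemma mult_in_covers: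
  assumes "covers A B" shows "mult_in S B = mult_in S A + of_bool (factor A B S)"
proof -
  obtain k where k: "series_count S A k" using series_count_ex coversD(1)[OF assms] by blast
  show ?thesis
    using mult_in_eqI[OF series_count.step[OF k assms]] mult_in_eqI[OF k] by simp
qed

section \<open>Composition series as lists of codes\<close>

lemma composition_series_iff:
  "composition_series GG (F2_space n) Ms \<longleftrightarrow> Ms \<noteq> [] \<and> hd Ms = {0} \<and> last Ms = V \<and>
    (\<forall>i. Suc i < length Ms \<longrightarrow> covers (Ms ! i) (Ms ! Suc i))" (is "?L \<longleftrightarrow> ?R")
proof -
  have simple: "simple_gmodule GG (series_factor (F2_space n) Ms i) \<longleftrightarrow> covers (Ms ! i) (Ms ! Suc i)"
    if codes: "inv_code (Ms ! i)" "inv_code (Ms ! Suc i)" and sub: "Ms ! i \<subseteq> Ms ! Suc i" for i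
  proof -
    obtain h where "factor_map h (Ms ! i) (Ms ! Suc i) (series_factor (F2_space n) Ms i)"
      using factor_quotient[OF codes sub] by (auto simp: factor_def series_factor_def)
    then show ?thesis using simple_factor_iff codes by blast
  qed
  show ?thesis
  proof
    assume L: ?L
    then have "inv_code (Ms ! i)" if "i < length Ms" for i
      using that by (auto simp: composition_series_def inv_code_iff)
    with L simple show ?R by (auto simp: composition_series_def)
  next
    assume R: ?R
    \<comment> \<open>The first member is \<open>{0}\<close> and every later one covers its
      predecessor, so all members are invariant codes.\<close>
    have codes: "inv_code (Ms ! i)" if "i < length Ms" for i
    proof (cases i)
      case 0 then show ?thesis using R inv_code_zero by (metis hd_conv_nth)
    next
      case (Suc j) then show ?thesis using R that coversD(2) by blast
    qed
    then have "\<forall>N\<in>set Ms. gsubmodule GG (F2_space n) N" by (auto simp: in_set_conv_nth inv_code_iff)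
    moreover have "Ms ! i \<subseteq> Ms ! Suc i \<and> simple_gmodule GG (series_factor (F2_space n) Ms i)"
      if "Suc i < length Ms" for i
      using R that simple[of i] codes coversD(3)[of "Ms ! i" "Ms ! Suc i"] by auto
    ultimately show ?L using R by (auto simp: composition_series_def)
  qed
qed

definition factor_count :: "('b, nat \<Rightarrow> nat) gmodule \<Rightarrow> (nat \<Rightarrow> bit) set list \<Rightarrow> nat" where
  "factor_count S Ms = card {i. Suc i < length Ms \<and> factor (Ms ! i) (Ms ! Suc i) S}"

lemma factor_count_snoc:
  assumes "Ms \<noteq> []"
  shows "factor_count S (Ms @ [B]) = factor_count S Ms + of_bool (factor (last Ms) B S)"
proof -
  \<comment> \<open>\<open>m\<close> is the index of the last member, the only index at which
    appending \<open>B\<close> creates a factor.\<close>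
  obtain m where m: "length Ms = Suc m" using assms by (cases Ms) auto
  have last: "last Ms = Ms ! m" using assms m by (simp add: last_conv_nth)
  have "{i. Suc i < length (Ms @ [B]) \<and> factor ((Ms @ [B]) ! i) ((Ms @ [B]) ! Suc i) S}
    = {i. Suc i < length Ms \<and> factor (Ms ! i) (Ms ! Suc i) S} \<union> (if factor (last Ms) B S then {m} else {})"
    by (auto simp: nth_append m last less_Suc_eq split: if_splits)
  moreover have "finite {i. Suc i < length Ms \<and> factor (Ms ! i) (Ms ! Suc i) S}"
    by (rule finite_subset[of _ "{..length Ms}"]) auto
  ultimately show ?thesis by (simp add: factor_count_def m)
qed

text \<open>The rule \<open>step\<close> adds a code at the top, so lists are built up and taken
  apart at their end.\<close>

lemma series_count_iff:
  "series_count S B k \<longleftrightarrow> (\<exists>Ms. Ms \<noteq> [] \<and> hd Ms = {0} \<and> last Ms = B \<and>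
    (\<forall>i. Suc i < length Ms \<longrightarrow> covers (Ms ! i) (Ms ! Suc i)) \<and> k = factor_count S Ms)"
proof
  assume "series_count S B k"
  then show "\<exists>Ms. Ms \<noteq> [] \<and> hd Ms = {0} \<and> last Ms = B \<and>
    (\<forall>i. Suc i < length Ms \<longrightarrow> covers (Ms ! i) (Ms ! Suc i)) \<and> k = factor_count S Ms"
  proof induction
    case zero
    show ?case by (rule exI[of _ "[{0}]"]) (simp add: factor_count_def zero_fun_def)
  next
    case (step A k B)
    then obtain Ms where Ms: "Ms \<noteq> []" "hd Ms = {0}" "last Ms = A"
      "\<forall>i. Suc i < length Ms \<longrightarrow> covers (Ms ! i) (Ms ! Suc i)" "k = factor_count S Ms" by blast
    obtain m where m: "length Ms = Suc m" using Ms(1) by (cases Ms) auto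
    have last: "Ms ! m = A" using Ms m by (simp add: last_conv_nth)
    have "covers ((Ms @ [B]) ! i) ((Ms @ [B]) ! Suc i)" if "Suc i < length (Ms @ [B])" for i
      using that Ms(4) step(2) last by (auto simp: nth_append m less_Suc_eq)
    then show ?case
      using Ms factor_count_snoc[OF Ms(1), of S B] by (intro exI[of _ "Ms @ [B]"]) auto
  qed
next
  assume "\<exists>Ms. Ms \<noteq> [] \<and> hd Ms = {0} \<and> last Ms = B \<and>
    (\<forall>i. Suc i < length Ms \<longrightarrow> covers (Ms ! i) (Ms ! Suc i)) \<and> k = factor_count S Ms"
  then obtain Ms where "Ms \<noteq> []" "hd Ms = {0}" "last Ms = B"
    "\<forall>i. Suc i < length Ms \<longrightarrow> covers (Ms ! i) (Ms ! Suc i)" "k = factor_count S Ms" by blast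
  then show "series_count S B k"
  proof (induction Ms arbitrary: B k rule: rev_induct)
    case Nil then show ?case by simp
  next
    case (snoc A Ms)
    show ?case
    proof (cases "Ms = []")
      case True
      then show ?thesis using snoc.prems series_count.zero by (auto simp: factor_count_def zero_fun_def)
    next
      case False
      then obtain m where m: "length Ms = Suc m" by (cases Ms) auto
      have last: "Ms ! m = last Ms" using False m by (simp add: last_conv_nth)
      have c: "covers (Ms ! i) (Ms ! Suc i)" if "Suc i < length Ms" for i
        using snoc.prems(4)[rule_format, of i] that by (simp add: nth_append)
      have "covers (last Ms) B"
        using snoc.prems(4)[rule_format, of m] snoc.prems(3) last by (simp add: nth_append m)
      moreover have "series_count S (last Ms) (factor_count S Ms)"
        by (rule snoc.IH) (use snoc.prems c False in auto)
      ultimately show ?thesis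
        using series_count.step snoc.prems factor_count_snoc[OF False, of S A] by force
    qed
  qed
qed

text \<open>For the factors of a series, \<open>gmodule_iso\<close> to \<open>S\<close> and
  \<open>factor\<close> mean the same, so the two definite descriptions have equivalent predicates.
  Uniqueness is then \<open>series_count_unique\<close>.\<close>

lemma factor_multiplicity_eq:
  assumes S: "F2G_module GG S"
  shows "factor_multiplicity GG (F2_space n) S = mult_in S V"
proof -
  have "card {i. Suc i < length Ms \<and> gmodule_iso GG (series_factor (F2_space n) Ms i) S}
      = factor_count S Ms" if Ms: "composition_series GG (F2_space n) Ms" for Ms
  proof -
    have "gmodule_iso GG (series_factor (F2_space n) Ms i) S \<longleftrightarrow> factor (Ms ! i) (Ms ! Suc i) S"
      if "Suc i < length Ms" for i
    proof -
      have "covers (Ms ! i) (Ms ! Suc i)" using Ms that by (simp add: composition_series_iff)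
      note c = coversD[OF this]
      have q: "factor (Ms ! i) (Ms ! Suc i) (series_factor (F2_space n) Ms i)"
        unfolding series_factor_def using factor_quotient[OF c(1,2)] c(3) by auto
      show ?thesis
        using factor_gmodule_iso[OF _ q c(2) S] factor_iso[OF q _ c(2)] by blast
    qed
    then show ?thesis unfolding factor_count_def by (intro arg_cong[of _ _ card]) auto
  qed
  then have "(\<exists>Ms. composition_series GG (F2_space n) Ms \<and>
     m = card {i. Suc i < length Ms \<and> gmodule_iso GG (series_factor (F2_space n) Ms i) S})
     \<longleftrightarrow> (\<exists>Ms. composition_series GG (F2_space n) Ms \<and> m = factor_count S Ms)" for m
    by (intro ex_cong1) auto
  also have "\<dots> m \<longleftrightarrow> series_count S V m" for m
    unfolding series_count_iff composition_series_iff by (simp only: conj_assoc)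
  finally show ?thesis unfolding factor_multiplicity_def mult_in_def by simp
qed

end

section \<open>Orthogonality and duality\<close>

definition bil :: "nat \<Rightarrow> (nat \<Rightarrow> bit) \<Rightarrow> (nat \<Rightarrow> bit) \<Rightarrow> bit" where
  "bil n v w = (\<Sum>i=1..n. v i * w i)"

lemma bil_commute: "bil n v w = bil n w v"
  unfolding bil_def by (simp only: mult.commute)

lemma bil_add_left: "bil n (v + w) u = bil n v u + bil n w u"
  unfolding bil_def by (simp only: plus_fun_apply distrib_right sum.distrib)

lemma bil_add_right: "bil n u (v + w) = bil n u v + bil n u w"
  using bil_add_left bil_commute by metis

lemma bil_0 [simp]: "bil n 0 v = 0" "bil n v 0 = 0"
  by (simp_all add: bil_def)

lemma bil_comp: "g permutes {1..n} \<Longrightarrow> bil n (v \<circ> g) (w \<circ> g) = bil n v w"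
  unfolding bil_def using sum.permute[of g "{1..n}" "\<lambda>i. v i * w i"] by (simp only: o_def)

section \<open>Extension and representation of linear functionals\<close>

lemma additive_coordinates:
  fixes f :: "(nat \<Rightarrow> bit) \<Rightarrow> bit"
  assumes f: "\<And>x y. x \<in> carrier (F2_space n) \<Longrightarrow> y \<in> carrier (F2_space n) \<Longrightarrow> f (x + y) = f x + f y"
  assumes "finite I" "I \<subseteq> {1..n}" "\<forall>i. i \<notin> I \<longrightarrow> a i = 0"
  shows "f a = (\<Sum>i\<in>I. a i * f (\<lambda>j. if j = i then 1 else 0))"
  using assms(2-)
proof (induction I arbitrary: a rule: finite_induct)
  case empty
  then have "a = 0" by (simp add: fun_eq_iff)
  moreover have "f 0 = f 0 + f 0" using f[of 0 0] by simp
  ultimately show ?case by (simp add: zero_fun_def)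
next
  case (insert k I)
  let ?e = "\<lambda>j. if j = k then 1 else (0 :: bit)"
  show ?case
  proof (cases "a k = 0")
    case zero: True
    then have "\<forall>i. i \<notin> I \<longrightarrow> a i = 0" using insert.prems by auto
    then show ?thesis using insert zero by simp
  next
    case False
    then have one: "a k = 1" by simp
    \<comment> \<open>Adding the unit vector clears coordinate \<open>k\<close>, so the induction
      hypothesis applies to \<open>?a\<close>.\<close>
    let ?a = "a + ?e"
    have supp: "\<forall>i. i \<notin> I \<longrightarrow> ?a i = 0" using one insert.prems by auto
    then have "f ?a = (\<Sum>i\<in>I. ?a i * f (\<lambda>j. if j = i then 1 else 0))"
      using insert by auto
    also have "\<dots> = (\<Sum>i\<in>I. a i * f (\<lambda>j. if j = i then 1 else 0))"
      by (rule sum.cong) (use insert.hyps in auto)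
    finally have fa: "f ?a = (\<Sum>i\<in>I. a i * f (\<lambda>j. if j = i then 1 else 0))" .
    have "f (?e + ?a) = f ?e + f ?a"
      by (rule f) (use insert.prems supp in auto)
    moreover have "?e + ?a = a" by simp
    ultimately have "f a = f ?e + f ?a" by metis
    then show ?thesis
      using fa insert.hyps one by (simp only: sum.insert) simp
  qed
qed

text \<open>One step of extending a functional: \<open>A'\<close> is \<open>A\<close> together with
  the coset of \<open>w\<close>, and \<open>f'\<close> takes the value \<open>c\<close> at
  \<open>w\<close>. Any extension will do in \<open>functional_extension\<close>, which takes
  \<open>c = 0\<close>; \<open>perp_perp\<close> takes \<open>c = 1\<close> to separate
  \<open>w\<close> from \<open>A\<close>.\<close>

lemma functional_adjoin:
  fixes f :: "(nat \<Rightarrow> bit) \<Rightarrow> bit" and c :: bit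
  assumes A: "A \<subseteq> carrier (F2_space n)" "0 \<in> A" "\<And>x y. x \<in> A \<Longrightarrow> y \<in> A \<Longrightarrow> x + y \<in> A"
      "\<And>x y. x \<in> A \<Longrightarrow> y \<in> A \<Longrightarrow> f (x + y) = f x + f y"
    and w: "w \<in> carrier (F2_space n)" "w \<notin> A"
  defines "A' \<equiv> {x. x \<in> A \<or> w + x \<in> A}" and "f' \<equiv> \<lambda>x. if x \<in> A then f x else f (w + x) + c"
  shows "A' \<subseteq> carrier (F2_space n)" "0 \<in> A'" "\<And>x y. x \<in> A' \<Longrightarrow> y \<in> A' \<Longrightarrow> x + y \<in> A'"
    "\<And>x y. x \<in> A' \<Longrightarrow> y \<in> A' \<Longrightarrow> f' (x + y) = f' x + f' y"
proof -
  have canc: "x + y \<in> A \<longleftrightarrow> y \<in> A" if "x \<in> A" for x y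
    using A(3)[of x y] A(3)[of x "x + y"] that by auto
  have canc': "y + x \<in> A \<longleftrightarrow> y \<in> A" if "x \<in> A" for x y
    using canc[OF that, of y] by (simp add: add.commute)
  \<comment> \<open>Two vectors in the coset of \<open>w\<close> have their sum in \<open>A\<close>:
    \<open>w\<close> cancels, and so does \<open>c\<close> in the sum of their values.\<close>
  have both: "x + y \<in> A" "f (x + y) = f (w + x) + f (w + y)" if "w + x \<in> A" "w + y \<in> A" for x y
  proof -
    have "(w + x) + (w + y) = x + y" by (metis add.assoc add.commute bit_add_self_fun')
    then show "x + y \<in> A" "f (x + y) = f (w + x) + f (w + y)"
      using A(3,4)[OF that] by simp_all
  qed
  have "x \<in> carrier (F2_space n)" if "w + x \<in> A" for x
  proof -
    have "w + x \<in> carrier (F2_space n)" using that A(1) by blast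
    then have "w + (w + x) \<in> carrier (F2_space n)"
      using w(1) by (auto simp del: bit_add_self_fun')
    then show ?thesis by simp
  qed
  then show "A' \<subseteq> carrier (F2_space n)" using A(1) unfolding A'_def by blast
  show "0 \<in> A'" using A(2) by (simp add: A'_def)
  fix x y assume xy: "x \<in> A'" "y \<in> A'"
  have l: "w + (x + y) = (w + x) + y" "w + (x + y) = x + (w + y)"
    by (simp_all add: algebra_simps)
  show "x + y \<in> A'"
    using xy both(1)[of x y] canc[of x y] canc[of x "w + y"] canc'[of y "w + x"]
    unfolding A'_def mem_Collect_eq by (metis A(3) l)
  show "f' (x + y) = f' x + f' y"
  proof (cases "x \<in> A")
    case x: True
    show ?thesis
    proof (cases "y \<in> A")
      case True then show ?thesis using x A(3,4) by (simp add: f'_def)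
    next
      case False
      then have "w + y \<in> A" "x + y \<notin> A" using xy canc[OF x] by (auto simp: A'_def)
      then show ?thesis using A(4)[OF x, of "w + y"] x False by (simp add: f'_def l(2) add.assoc)
    qed
  next
    case x: False
    then have wx: "w + x \<in> A" using xy by (auto simp: A'_def)
    show ?thesis
    proof (cases "y \<in> A")
      case True
      then have "x + y \<notin> A" using canc' x by auto
      then have "f' (x + y) = f (w + x) + f y + c"
        using A(4)[OF wx True] by (simp add: f'_def l(1))
      then show ?thesis using x True by (simp add: f'_def ac_simps)
    next
      case False
      then have wy: "w + y \<in> A" using xy by (auto simp: A'_def)
      then show ?thesis using both[OF wx wy] x False by (cases c) (simp_all add: f'_def ac_simps)
    qed
  qed
qed

text \<open>Vectors are adjoined until \<open>A\<close> is the whole space. There the functional is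
  determined by its values on the unit vectors, which are the coordinates of
  \<open>v\<close>.\<close>

lemma functional_extension:
  fixes f :: "(nat \<Rightarrow> bit) \<Rightarrow> bit"
  assumes "A \<subseteq> carrier (F2_space n)" "0 \<in> A" "\<And>x y. x \<in> A \<Longrightarrow> y \<in> A \<Longrightarrow> x + y \<in> A"
    and "\<And>x y. x \<in> A \<Longrightarrow> y \<in> A \<Longrightarrow> f (x + y) = f x + f y"
    and fin: "finite (carrier (F2_space n))"
  shows "\<exists>v\<in>carrier (F2_space n). \<forall>a\<in>A. bil n v a = f a"
  using assms(1-4)
proof (induction "card (carrier (F2_space n) - A)" arbitrary: A f rule: less_induct)
  case less
  let ?V = "carrier (F2_space n)"
  note A = less.prems
  show ?case
  proof (cases "A = ?V")
    case True
    define v where "v = (\<lambda>i. if i \<in> {1..n} then f (\<lambda>j. if j = i then 1 else 0) else 0)"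
    have "bil n v a = f a" if "a \<in> A" for a
    proof -
      have "f a = (\<Sum>i\<in>{1..n}. a i * f (\<lambda>j. if j = i then 1 else 0))"
      proof (rule additive_coordinates)
        show "f (x + y) = f x + f y" if "x \<in> ?V" "y \<in> ?V" for x y
          by (rule A(4)) (use True that in blast)+
        show "\<forall>i. i \<notin> {1..n} \<longrightarrow> a i = 0"
          using \<open>a \<in> A\<close> True F2_space_simps(4) by blast
      qed simp_all
      then show ?thesis
        unfolding bil_def by (auto simp: v_def mult.commute intro!: sum.cong)
    qed
    moreover have "v \<in> ?V" by (simp add: v_def)
    ultimately show ?thesis by blast
  next
    case False
    then obtain w where w: "w \<in> ?V" "w \<notin> A" using A(1) by blast
    let ?A' = "{x. x \<in> A \<or> w + x \<in> A}" and ?f' = "\<lambda>x. if x \<in> A then f x else f (w + x) + 0"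
    note adj = functional_adjoin(1-3)[OF A w] functional_adjoin(4)[OF A w, where c = 0]
    have "\<exists>v\<in>?V. \<forall>a\<in>?A'. bil n v a = ?f' a"
    proof (rule less.hyps[OF _ adj])
      have "w \<in> ?A'" using A(2) by simp
      then have "?V - ?A' \<subset> ?V - A" using w by blast
      then show "card (?V - ?A') < card (?V - A)" using fin by (intro psubset_card_mono) auto
    qed
    then show ?thesis by auto
  qed
qed

section \<open>Orthogonal complements of invariant codes\<close>

context perm_group begin

abbreviation perp :: "(nat \<Rightarrow> bit) set \<Rightarrow> (nat \<Rightarrow> bit) set" where "perp \<equiv> dual_code n"

lemma perp_iff: "v \<in> perp A \<longleftrightarrow> v \<in> V \<and> (\<forall>a\<in>A. bil n v a = 0)"
  unfolding dual_code_def bil_def by blast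

text \<open>The form is invariant, so the adjoint of \<open>g\<close> is its inverse. This matches
  the inverse in the action on \<open>dual_gmodule\<close>.\<close>

lemma bil_comp_left:
  assumes "g \<in> G" shows "bil n (v \<circ> g) x = bil n v (x \<circ> inv\<^bsub>GG\<^esub> g)"
proof -
  have "(x \<circ> inv\<^bsub>GG\<^esub> g) \<circ> g = x" using inv_in_G(2)[OF assms] by (simp add: comp_assoc)
  then show ?thesis using bil_comp[OF G_permutes[OF assms], of v "x \<circ> inv\<^bsub>GG\<^esub> g"] by simp
qed

lemma inv_code_perp:
  assumes "inv_code A" shows "inv_code (perp A)"
proof -
  note AD = inv_codeD[OF assms]
  show ?thesis
    unfolding inv_code_def
  proof (intro conjI ballI)
    fix x y assume "x \<in> perp A" "y \<in> perp A"
    then show "x + y \<in> perp A" by (simp add: perp_iff bil_add_left)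
  next
    fix x g assume "x \<in> perp A" "g \<in> G"
    then show "x \<circ> g \<in> perp A"
      using V_comp AD(4) inv_in_G(1) by (simp add: perp_iff bil_comp_left del: F2_space_simps(4))
  qed (auto simp: perp_iff simp del: F2_space_simps(4) simp: inv_codeD(2)[OF inv_code_V])
qed

lemma functional_rep:
  assumes "inv_code A" "\<And>x y. x \<in> A \<Longrightarrow> y \<in> A \<Longrightarrow> f (x + y) = f x + f y"
  obtains v where "v \<in> V" "\<And>a. a \<in> A \<Longrightarrow> bil n v a = f a"
  using functional_extension[OF inv_codeD(1-3)[OF assms(1)] assms(2) finite_V] by blast

text \<open>For \<open>w\<close> outside \<open>A\<close>, the zero functional on \<open>A\<close>
  extends with value 1 at \<open>w\<close>. A vector representing it lies in \<open>perp A\<close>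
  but is not orthogonal to \<open>w\<close>.\<close>

lemma perp_perp:
  assumes A: "inv_code A" shows "perp (perp A) = A"
proof
  note AD = inv_codeD[OF A]
  show "A \<subseteq> perp (perp A)"
  proof
    fix x assume x: "x \<in> A"
    have "bil n x a = 0" if "a \<in> perp A" for a
      using that x by (subst bil_commute) (simp add: perp_iff)
    then show "x \<in> perp (perp A)" using AD(1) x perp_iff by blast
  qed
  show "perp (perp A) \<subseteq> A"
  proof (rule subsetI, rule ccontr)
    fix w assume w: "w \<in> perp (perp A)" "w \<notin> A"
    have wV: "w \<in> V" using w by (simp add: perp_iff)
    define z :: "(nat \<Rightarrow> bit) \<Rightarrow> bit" where "z = (\<lambda>_. 0)"
    have z: "z (x + y) = z x + z y" for x y by (simp add: z_def)
    let ?A' = "{x. x \<in> A \<or> w + x \<in> A}" and ?f = "\<lambda>x. if x \<in> A then z x else z (w + x) + 1"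
    note adj = functional_adjoin(1-3)[OF AD(1-3) z wV w(2)]
      functional_adjoin(4)[OF AD(1-3) z wV w(2), where c = 1]
    have "\<exists>v\<in>V. \<forall>a\<in>?A'. bil n v a = ?f a"
      by (rule functional_extension[OF adj finite_V])
    then obtain v where v: "v \<in> V" "\<And>a. a \<in> ?A' \<Longrightarrow> bil n v a = ?f a" by blast
    have "v \<in> perp A" using v by (auto simp: perp_iff z_def simp del: F2_space_simps(4))
    moreover have "bil n v w = 1" using v(2)[of w] AD(2) w(2) by (simp add: z_def)
    ultimately show False using w(1) bil_commute[of n v w] by (auto simp: perp_iff)
  qed
qed

lemma perp_antimono: "A \<subseteq> B \<Longrightarrow> perp B \<subseteq> perp A"
  by (auto simp: dual_code_def)

lemma perp_subset_iff:
  assumes "inv_code A" "inv_code B" shows "perp B \<subseteq> perp A \<longleftrightarrow> A \<subseteq> B"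
  using perp_antimono perp_perp assms by metis

lemma perp_zero: "perp {0} = V"
  by (auto simp: perp_iff)

lemma perp_csum:
  assumes A: "inv_code A" and B: "inv_code B"
  shows "perp (csum A B) = perp A \<inter> perp B"
proof
  show "perp (csum A B) \<subseteq> perp A \<inter> perp B"
    using inv_code_csum[OF assms] perp_antimono by blast
  show "perp A \<inter> perp B \<subseteq> perp (csum A B)"
    by (auto simp: perp_iff csum_def bil_add_right)
qed

text \<open>By \<open>perp_perp\<close>, taking complements is an order-reversing involution on
  invariant codes, and so reverses covers.\<close>

lemma covers_perp:
  assumes "covers A B" shows "covers (perp B) (perp A)"
proof -
  note c = coversD[OF assms]
  have "N = perp B \<or> N = perp A" if N: "inv_code N" "perp B \<subseteq> N" "N \<subseteq> perp A" for N
  proof -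
    have "A \<subseteq> perp N" "perp N \<subseteq> B"
      using perp_antimono[OF N(2)] perp_antimono[OF N(3)] perp_perp c by auto
    then show ?thesis using c(4)[OF inv_code_perp[OF N(1)]] perp_perp[OF N(1)] by auto
  qed
  moreover have "perp B \<subset> perp A"
    using c perp_subset_iff by (metis psubset_eq perp_perp)
  ultimately show ?thesis using c inv_code_perp by (simp add: covers_def)
qed

text \<open>Pairing with \<open>v\<close> in \<open>perp A\<close> vanishes on \<open>A\<close> and
  so descends to a functional \<open>h v\<close> on \<open>S\<close>. It is zero exactly for
  \<open>v\<close> in \<open>perp B\<close>, and every functional arises because functionals on
  \<open>B\<close> are represented by vectors.\<close>

lemma factor_perp:
  assumes "factor A B S" and A: "inv_code A" and B: "inv_code B"
  shows "factor (perp B) (perp A) (dual_gmodule GG S)"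
proof -
  obtain f where f: "factor_map f A B S" using assms by (auto simp: factor_def)
  interpret S: F2G_module GG S using F2G_module_factor[OF f B] .
  note fD = factor_mapD[OF f] and AD = inv_codeD[OF A] and BD = inv_codeD[OF B]
  define h where "h = (\<lambda>v. \<lambda>s\<in>carrier S. bil n v (inv_into B f s))"
  have h: "h v (f x) = bil n v x" if "v \<in> perp A" "x \<in> B" for v x
  proof -
    have y: "inv_into B f (f x) \<in> B" "f (inv_into B f (f x)) = f x"
      using inv_into_into[OF imageI[OF that(2)], of f] f_inv_into_f[OF imageI[OF that(2)], of f] by auto
    then have "bil n v (inv_into B f (f x) + x) = 0"
      using factor_map_eq[OF f B y(1) that(2)] that(1) by (simp add: perp_iff)
    then show ?thesis using fD(9)[OF that(2)] by (simp add: h_def bil_add_right bit_add_eq_0)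
  qed
  have ext: "h v \<in> extensional (carrier S)" for v by (simp add: h_def)
  \<comment> \<open>Elements of the dual are extensional and \<open>f\<close> is onto, so it
    suffices to compare values at \<open>f x\<close>.\<close>
  have eqI: "\<phi> = \<psi>" if "\<phi> \<in> extensional (carrier S)" "\<psi> \<in> extensional (carrier S)"
    "\<And>x. x \<in> B \<Longrightarrow> \<phi> (f x) = \<psi> (f x)" for \<phi> \<psi> :: "_ \<Rightarrow> bit"
  proof (rule extensionalityI[OF that(1,2)])
    fix s assume "s \<in> carrier S"
    then obtain x where "x \<in> B" "s = f x" using fD(1) by blast
    then show "\<phi> s = \<psi> s" using that(3) by simp
  qed
  have all: "(\<forall>s\<in>carrier S. P s) \<longleftrightarrow> (\<forall>x\<in>B. P (f x))" for P
    unfolding fD(1)[symmetric] by auto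
  have hcarr: "h v \<in> carrier (dual_gmodule GG S)" if v: "v \<in> perp A" for v
  proof -
    have "h v (a \<odot>\<^bsub>S\<^esub> f x) = a * h v (f x)" if "x \<in> B" for a x
      using fD(5,6)[OF fD(9)[OF that]] h[OF v BD(2)] fD(2) by (cases a) auto
    moreover have "h v (f x \<oplus>\<^bsub>S\<^esub> f y) = h v (f x) + h v (f y)" if "x \<in> B" "y \<in> B" for x y
      using h[OF v] BD(3) that by (simp add: bil_add_right flip: fD(3))
    ultimately show ?thesis using ext by (simp add: dual_gmodule_def all)
  qed
  have surj: "\<exists>v\<in>perp A. h v = \<phi>" if "\<phi> \<in> carrier (dual_gmodule GG S)" for \<phi>
  proof -
    have \<phi>: "\<phi> \<in> extensional (carrier S)"
      "\<And>x y. x \<in> carrier S \<Longrightarrow> y \<in> carrier S \<Longrightarrow> \<phi> (x \<oplus>\<^bsub>S\<^esub> y) = \<phi> x + \<phi> y"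
      "\<And>a x. x \<in> carrier S \<Longrightarrow> \<phi> (a \<odot>\<^bsub>S\<^esub> x) = a * \<phi> x"
      using that by (auto simp: dual_gmodule_def)
    have \<phi>0: "\<phi> \<zero>\<^bsub>S\<^esub> = 0"
      using \<phi>(3)[of "\<zero>\<^bsub>S\<^esub>" 0] S.smult_bit(1)[of "\<zero>\<^bsub>S\<^esub>"] by simp
    have "\<phi> (f (x + y)) = \<phi> (f x) + \<phi> (f y)" if "x \<in> B" "y \<in> B" for x y
      using fD(3,9) \<phi>(2) that by simp
    \<comment> \<open>The functional is pulled back to \<open>B\<close> along \<open>f\<close>. A
      vector representing the pullback is orthogonal to \<open>A\<close>, the kernel of
      \<open>f\<close>.\<close>
    then obtain v where v: "v \<in> V" "\<And>x. x \<in> B \<Longrightarrow> bil n v x = \<phi> (f x)"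
      using functional_rep[OF B, of "\<lambda>x. \<phi> (f x)"] by blast
    have "bil n v a = 0" if "a \<in> A" for a
    proof -
      have "a \<in> B" using fD(8) that by blast
      then show ?thesis using v(2)[of a] fD(7)[of a] that \<phi>0 by simp
    qed
    then have "v \<in> perp A" using v(1) perp_iff by blast
    moreover from this have "h v = \<phi>" using eqI[OF ext \<phi>(1)] h v(2) by simp
    ultimately show ?thesis by blast
  qed
  note PD = inv_codeD[OF inv_code_perp[OF A]]
  have "factor_map h (perp B) (perp A) (dual_gmodule GG S)"
    unfolding factor_map_def
  proof (intro conjI ballI)
    show "h ` perp A = carrier (dual_gmodule GG S)" using hcarr surj by blast
    have r: "zero (dual_gmodule GG S) = (\<lambda>s\<in>carrier S. 0)"
      "\<phi> \<oplus>\<^bsub>dual_gmodule GG S\<^esub> \<psi> = (\<lambda>s\<in>carrier S. \<phi> s + \<psi> s)"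
      "\<phi> \<cdot>\<^bsub>dual_gmodule GG S\<^esub> g = (\<lambda>s\<in>carrier S. \<phi> (s \<cdot>\<^bsub>S\<^esub> (inv\<^bsub>GG\<^esub> g)))"
      "a \<odot>\<^bsub>dual_gmodule GG S\<^esub> \<phi> = (\<lambda>s\<in>carrier S. a * \<phi> s)" for \<phi> \<psi> g a
      by (simp_all add: dual_gmodule_def)
    have h0: "h v = \<zero>\<^bsub>dual_gmodule GG S\<^esub> \<longleftrightarrow> v \<in> perp B" if v: "v \<in> perp A" for v
    proof -
      have "h v = \<zero>\<^bsub>dual_gmodule GG S\<^esub> \<longleftrightarrow> (\<forall>x\<in>B. h v (f x) = 0)"
        unfolding r using eqI[OF ext, of "\<lambda>s\<in>carrier S. 0" v] fD(9) by auto
      then show ?thesis using v h[OF v] perp_iff by auto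
    qed
    show "{v \<in> perp A. h v = \<zero>\<^bsub>dual_gmodule GG S\<^esub>} = perp B"
      using h0 perp_antimono[OF fD(8)] by blast
    show "h 0 = \<zero>\<^bsub>dual_gmodule GG S\<^esub>"
      using h0[OF PD(2)] inv_codeD(2)[OF inv_code_perp[OF B]] by simp
    show "h (v + w) = h v \<oplus>\<^bsub>dual_gmodule GG S\<^esub> h w" if vw: "v \<in> perp A" "w \<in> perp A" for v w
      unfolding r by (rule eqI[OF ext]) (simp_all add: h vw PD(3) fD(9) bil_add_left)
    show "h (v \<circ> g) = h v \<cdot>\<^bsub>dual_gmodule GG S\<^esub> g" if v: "v \<in> perp A" and g: "g \<in> G" for v g
    proof -
      have "h v (f x \<cdot>\<^bsub>S\<^esub> inv\<^bsub>GG\<^esub> g) = bil n (v \<circ> g) x" if "x \<in> B" for x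
        using that g v inv_in_G(1)[OF g] h BD(4) by (simp add: bil_comp_left flip: fD(4))
      then show ?thesis
        unfolding r by (intro eqI[OF ext]) (simp_all add: h v g PD(4) fD(9))
    qed
    fix \<phi> assume \<phi>: "\<phi> \<in> carrier (dual_gmodule GG S)"
    then have "\<phi> \<in> extensional (carrier S)" by (simp add: dual_gmodule_def)
    then show "0 \<odot>\<^bsub>dual_gmodule GG S\<^esub> \<phi> = \<zero>\<^bsub>dual_gmodule GG S\<^esub>"
      "1 \<odot>\<^bsub>dual_gmodule GG S\<^esub> \<phi> = \<phi>"
      by (simp_all add: r extensional_restrict)
  qed
  then show ?thesis by (auto simp: factor_def)
qed

text \<open>Self-duality turns the dual in \<open>factor_perp\<close> back into \<open>S\<close>.
  The converse is the same implication for the complements, by \<open>perp_perp\<close>.\<close>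

lemma factor_perp_iff:
  assumes S: "F2G_module GG S" "self_dual_gmodule GG S" and A: "inv_code A" and B: "inv_code B"
  shows "factor (perp B) (perp A) S \<longleftrightarrow> factor A B S"
proof -
  have *: "factor (perp B) (perp A) S" if "factor A B S" "inv_code A" "inv_code B" for A B
    using factor_gmodule_iso'[OF S(2)[unfolded self_dual_gmodule_def] factor_perp[OF that] _ S(1)]
      inv_code_perp that by blast
  show ?thesis
    using *[of A B] *[of "perp B" "perp A"] A B inv_code_perp perp_perp by auto
qed

text \<open>Passing from \<open>A'\<close> to a cover \<open>A\<close> adds the factor
  \<open>A/A'\<close> below and removes \<open>perp A'/perp A\<close> above. By
  \<open>factor_perp_iff\<close> both are isomorphic to \<open>S\<close> or neither is, so the sum
  stays constant. For \<open>perp C = C\<close> the multiplicity in \<open>V\<close> is therefore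
  even.\<close>

lemma mult_in_perp:
  assumes S: "F2G_module GG S" "self_dual_gmodule GG S" and "inv_code A"
  shows "mult_in S A + mult_in S (perp A) = mult_in S V"
  using assms(3)
proof (induction "card A" arbitrary: A rule: less_induct)
  case less
  show ?case
  proof (cases "A = {0}")
    case True then show ?thesis by (simp add: perp_zero mult_in_zero)
  next
    case False
    then have "{0} \<subset> A" using inv_codeD(2)[OF less.prems] by auto
    then obtain A' where A': "covers A' A" using covers_below_ex[OF less.prems inv_code_zero] by auto
    note c = coversD[OF A']
    have "card A' < card A" using c inv_codeD(5)[of A] psubset_card_mono by metis
    then have "mult_in S A' + mult_in S (perp A') = mult_in S V" using less.hyps c by blast
    then show ?thesis
      using mult_in_covers[OF A', of S] mult_in_covers[OF covers_perp[OF A'], of S]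
        factor_perp_iff[OF S c(1,2)] by simp
  qed
qed

section \<open>Self-dual codes invariant under the group\<close>

lemma self_dual_code_inv_code:
  assumes "self_dual_code n C" "G \<subseteq> Aut_code n C" shows "inv_code C" "perp C = C"
proof -
  have "c \<circ> g \<in> C" if "c \<in> C" "g \<in> G" for c g
    using assms(2) that by (auto simp: Aut_code_def subset_iff)
  then show "inv_code C"
    using assms(1) by (auto simp: self_dual_code_def gsubmodule_def simp flip: inv_code_iff)
  show "perp C = C" using assms(1) by (simp add: self_dual_code_def)
qed

lemma self_dual_codeI:
  assumes C: "inv_code C" "perp C = C" shows "self_dual_code n C \<and> G \<subseteq> Aut_code n C"
proof
  show "self_dual_code n C"
    using C by (auto simp: self_dual_code_def gsubmodule_def simp flip: inv_code_iff)
  note CD = inv_codeD[OF C(1)]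
  show "G \<subseteq> Aut_code n C"
  proof
    fix g assume g: "g \<in> G"
    \<comment> \<open>Invariance gives one inclusion of \<open>C\<close> and its image; the inverse
      of \<open>g\<close> provides the preimages for the other.\<close>
    have "c \<in> (\<lambda>c. c \<circ> g) ` C" if "c \<in> C" for c
      using CD(4)[OF that inv_in_G(1)[OF g]] inv_in_G(2)[OF g]
      by (intro image_eqI[of _ _ "c \<circ> inv\<^bsub>GG\<^esub> g"]) (simp_all add: comp_assoc)
    then show "g \<in> Aut_code n C"
      using CD(4) g G_permutes by (auto simp: Aut_code_def sym_group_carrier)
  qed
qed

end

section \<open>Invariant forms on simple modules\<close>

text \<open>On a finite carrier \<open>\<alpha>\<close> is a permutation of finite order
  \<open>m\<close>, which simplicity forces to be odd. Hence the power of \<open>\<alpha>\<close>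
  with exponent \<open>(m + 1)/2\<close> is a square root.\<close>

lemma (in F2G_module) simple_endomorphism_square_root:
  assumes simple: "simple_gmodule G M" and fin: "finite (carrier M)"
    and \<alpha>: "\<And>x. x \<in> carrier M \<Longrightarrow> \<alpha> x \<in> carrier M"
      "\<And>x y. x \<in> carrier M \<Longrightarrow> y \<in> carrier M \<Longrightarrow> \<alpha> (x \<oplus>\<^bsub>M\<^esub> y) = \<alpha> x \<oplus>\<^bsub>M\<^esub> \<alpha> y"
      "\<And>x g. x \<in> carrier M \<Longrightarrow> g \<in> carrier G \<Longrightarrow> \<alpha> (x \<cdot> g) = \<alpha> x \<cdot> g"
    and inj: "inj_on \<alpha> (carrier M)"
  obtains k where "\<And>x. x \<in> carrier M \<Longrightarrow> (\<alpha> ^^ k) ((\<alpha> ^^ k) x) = \<alpha> x"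
proof -
  have pow: "(\<alpha> ^^ k) x \<in> carrier M" if "x \<in> carrier M" for k x
    by (induction k) (auto simp: that \<alpha>(1))
  have pow_add: "(\<alpha> ^^ k) (x \<oplus>\<^bsub>M\<^esub> y) = (\<alpha> ^^ k) x \<oplus>\<^bsub>M\<^esub> (\<alpha> ^^ k) y" if "x \<in> carrier M" "y \<in> carrier M" for k x y
    by (induction k) (auto simp: that \<alpha>(2) pow)
  have pow_act: "(\<alpha> ^^ k) (x \<cdot> g) = (\<alpha> ^^ k) x \<cdot> g" if "x \<in> carrier M" "g \<in> carrier G" for k x g
    by (induction k) (auto simp: that \<alpha>(3) pow)
  define period where "period = (\<lambda>m. m > 0 \<and> (\<forall>x\<in>carrier M. (\<alpha> ^^ m) x = x))"
  have "\<exists>m. period m"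
  proof -
    \<comment> \<open>Extending \<open>\<alpha>\<close> by the identity gives a permutation of the
      whole type, for which a finite order is known to exist.\<close>
    define p where "p = (\<lambda>x. if x \<in> carrier M then \<alpha> x else x)"
    have "\<alpha> ` carrier M = carrier M"
      using \<alpha>(1) inj fin by (intro endo_inj_surj) auto
    then have "bij_betw p (carrier M) (carrier M)"
      using inj by (auto simp: bij_betw_def p_def inj_on_def)
    then have "p permutes carrier M"
      by (rule bij_imp_permutes) (simp add: p_def)
    then have "permutation p" using fin permutation_permutes by blast
    then obtain m where m: "(p ^^ m) = id" "m > 0"
      using permutation_is_nilpotent by blast
    have "(p ^^ k) x = (\<alpha> ^^ k) x" if "x \<in> carrier M" for k x
      by (induction k) (auto simp: that pow p_def)
    then have "period m" using m by (simp add: period_def) (metis id_apply)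
    then show ?thesis ..
  qed
  \<comment> \<open>Minimality of \<open>m\<close> will exclude the period
    \<open>m/2\<close>.\<close>
  then obtain m where m: "period m" and least: "\<And>k. k < m \<Longrightarrow> \<not> period k"
    using exists_least_iff[of period] by blast
  \<comment> \<open>An involution \<open>\<gamma>\<close> would give \<open>(\<gamma> + 1)\<^sup>2 = 0\<close>, so \<open>\<gamma> = 1\<close> because the kernel of \<open>\<gamma> + 1\<close> is a submodule.\<close>
  have "odd m"
  proof
    assume "even m"
    then obtain k where k: "m = k + k" by (metis evenE mult_2)
    have kpos: "k > 0" "k < m" using m k by (auto simp: period_def)
    define \<gamma> where "\<gamma> = \<alpha> ^^ k"
    have \<gamma>: "\<gamma> (\<gamma> x) = x" if "x \<in> carrier M" for x
      using m that k by (simp add: period_def \<gamma>_def funpow_add)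
    define \<delta> where "\<delta> = (\<lambda>x. \<gamma> x \<oplus>\<^bsub>M\<^esub> x)"
    have \<gamma>c: "\<gamma> x \<in> carrier M" if "x \<in> carrier M" for x using pow that by (simp add: \<gamma>_def)
    have \<delta>c: "\<delta> x \<in> carrier M" if "x \<in> carrier M" for x using \<gamma>c that by (simp add: \<delta>_def)
    have \<gamma>a: "\<gamma> (x \<oplus>\<^bsub>M\<^esub> y) = \<gamma> x \<oplus>\<^bsub>M\<^esub> \<gamma> y" if "x \<in> carrier M" "y \<in> carrier M" for x y
      using pow_add that by (simp add: \<gamma>_def)
    have \<delta>a: "\<delta> (x \<oplus>\<^bsub>M\<^esub> y) = \<delta> x \<oplus>\<^bsub>M\<^esub> \<delta> y" if "x \<in> carrier M" "y \<in> carrier M" for x y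
      using \<gamma>a that \<gamma>c by (simp add: \<delta>_def M.a_ac)
    have \<delta>g: "\<delta> (x \<cdot> g) = \<delta> x \<cdot> g" if "x \<in> carrier M" "g \<in> carrier G" for x g
      using pow_act that \<gamma>c by (simp add: \<delta>_def \<gamma>_def act_add)
    have \<delta>\<delta>: "\<delta> (\<delta> x) = \<zero>\<^bsub>M\<^esub>" if "x \<in> carrier M" for x
    proof -
      have "\<delta> (\<delta> x) = (x \<oplus>\<^bsub>M\<^esub> \<gamma> x) \<oplus>\<^bsub>M\<^esub> (\<gamma> x \<oplus>\<^bsub>M\<^esub> x)"
        using \<gamma>a[of "\<gamma> x" x] \<gamma>[OF that] \<gamma>c that by (simp add: \<delta>_def)
      then show ?thesis using add_self[of "x \<oplus>\<^bsub>M\<^esub> \<gamma> x"] \<gamma>c that by (simp add: M.a_comm)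
    qed
    define N where "N = {x \<in> carrier M. \<delta> x = \<zero>\<^bsub>M\<^esub>}"
    have "\<delta> \<zero>\<^bsub>M\<^esub> = \<zero>\<^bsub>M\<^esub>"
      using \<delta>a[of "\<zero>\<^bsub>M\<^esub>" "\<zero>\<^bsub>M\<^esub>"] add_self[of "\<delta> \<zero>\<^bsub>M\<^esub>"] \<delta>c[of "\<zero>\<^bsub>M\<^esub>"] by simp
    then have "gsubmodule G M N"
      unfolding gsubmodule_iff N_def using \<delta>a \<delta>g act_closed act_zero by auto
    then consider "N = {\<zero>\<^bsub>M\<^esub>}" | "N = carrier M"
      using simple by (auto simp: simple_gmodule_def)
    then have "N = carrier M"
    proof cases
      \<comment> \<open>Every \<open>\<delta> x\<close> lies in the kernel \<open>N\<close>; if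
        \<open>N\<close> is trivial, then \<open>\<delta>\<close> vanishes, and \<open>N\<close> is
        everything after all.\<close>
      case 1
      have "x \<in> N" if "x \<in> carrier M" for x
      proof -
        have "\<delta> x \<in> N" using that \<delta>c \<delta>\<delta> by (simp add: N_def)
        then have "\<delta> x = \<zero>\<^bsub>M\<^esub>" using 1 by simp
        then show ?thesis using that by (simp add: N_def)
      qed
      then show ?thesis by (auto simp: N_def)
    qed
    then have "\<gamma> x = x" if "x \<in> carrier M" for x
      using that add_eq_zero[OF \<gamma>c[OF that] that] by (auto simp: N_def \<delta>_def)
    then have "period k" using kpos by (simp add: period_def \<gamma>_def)
    then show False using least kpos by blast
  qed
  then obtain k where k: "m = 2 * k + 1" by (rule oddE)
  have "(\<alpha> ^^ Suc k) ((\<alpha> ^^ Suc k) x) = \<alpha> x" if "x \<in> carrier M" for x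
  proof -
    have "(\<alpha> ^^ Suc k) ((\<alpha> ^^ Suc k) x) = (\<alpha> ^^ (Suc k + Suc k)) x"
      by (simp only: funpow_add comp_apply)
    also have "Suc k + Suc k = Suc m" using k by simp
    also have "(\<alpha> ^^ Suc m) x = \<alpha> x" using m that by (simp add: period_def)
    finally show ?thesis .
  qed
  then show ?thesis by (rule that)
qed

context perm_group begin

text \<open>The evenness hypothesis speaks only of modules with carrier in \<open>'a\<close>. Since
  \<open>'a\<close> is infinite, the finitely many cosets of \<open>C\<close> in \<open>T\<close>
  inject into it, and the module structure is carried over.\<close>

lemma simple_factor_copy:
  assumes "covers C T"
  obtains S :: "('a::infinite, nat \<Rightarrow> nat) gmodule" where "simple_gmodule GG S" "factor C T S"
proof -
  note c = coversD[OF assms]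
  note TD = inv_codeD[OF c(2)] and CD = inv_codeD[OF c(1)]
  define K where "K = (\<lambda>x. {y. x + y \<in> C})"
  have "finite (K ` T)" using TD(5) by simp
  then obtain j :: "_ \<Rightarrow> 'a" where j: "inj_on j (K ` T)" using arb_inj_on_finite_infinite by blast
  define h where "h = (\<lambda>x. j (K x))"
  have K: "K x = K y \<longleftrightarrow> x + y \<in> C" for x y
    unfolding K_def by (rule coset_eq_iff[OF c(1)])
  have h: "h x = h y \<longleftrightarrow> x + y \<in> C" if "x \<in> T" "y \<in> T" for x y
    using j that K[of x y] unfolding h_def by (metis image_eqI inj_on_eq_iff)
  \<comment> \<open>\<open>r\<close> chooses a representative in \<open>T\<close>; the operations of
    \<open>S\<close> are computed on representatives.\<close>
  define r where "r = inv_into T h"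
  have r: "r (h x) \<in> T" "h (r (h x)) = h x" if "x \<in> T" for x
    using inv_into_into[OF imageI[OF that], of h] f_inv_into_f[OF imageI[OF that], of h]
    by (simp_all add: r_def)
  have rC: "r (h x) + x \<in> C" if "x \<in> T" for x
    using h[OF r(1)[OF that] that] r(2)[OF that] by simp
  define S :: "('a, nat \<Rightarrow> nat) gmodule" where "S = \<lparr>carrier = h ` T, monoid.mult = undefined, one = undefined,
     zero = h 0, add = (\<lambda>s t. h (r s + r t)), smult = (\<lambda>a s. if a = 0 then h 0 else s),
     act = (\<lambda>s g. h (r s \<circ> g))\<rparr>"
  have "factor_map h C T S"
    unfolding factor_map_def
  proof (intro conjI ballI)
    fix x y assume xy: "x \<in> T" "y \<in> T"
    have eq: "(x + y) + (r (h x) + r (h y)) = (r (h x) + x) + (r (h y) + y)" by (simp add: algebra_simps)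
    have "(x + y) + (r (h x) + r (h y)) \<in> C" unfolding eq by (intro CD(3) rC xy)
    then show "h (x + y) = h x \<oplus>\<^bsub>S\<^esub> h y"
      using h[of "x + y" "r (h x) + r (h y)"] xy r(1) TD(3) by (simp add: S_def)
  next
    fix x g assume xg: "x \<in> T" "g \<in> G"
    have "(x \<circ> g) + (r (h x) \<circ> g) \<in> C"
      using CD(4)[OF rC[OF xg(1)] xg(2)] by (simp add: comp_add add.commute)
    then show "h (x \<circ> g) = h x \<cdot>\<^bsub>S\<^esub> g"
      using h[of "x \<circ> g" "r (h x) \<circ> g"] xg r(1) TD(4) by (simp add: S_def)
  next
    have "h x = h 0 \<longleftrightarrow> x \<in> C" if "x \<in> T" for x using h[OF that TD(2)] by simp
    then show "{x \<in> T. h x = \<zero>\<^bsub>S\<^esub>} = C" using c(3) by (auto simp: S_def)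
  qed (auto simp: S_def)
  then show ?thesis
    using that simple_factor_iff[OF _ c(1,2)] assms unfolding factor_def by blast
qed

text \<open>The bilinear form induced on \<open>S\<close> by that on \<open>T\<close>, computed on
  chosen preimages. When the kernel of \<open>f\<close> is the radical
  \<open>T \<inter> perp T\<close>, the choice does not matter (\<open>form_eq\<close>) and the form
  is nondegenerate.\<close>

definition form :: "((nat \<Rightarrow> bit) \<Rightarrow> 'b) \<Rightarrow> (nat \<Rightarrow> bit) set \<Rightarrow> 'b \<Rightarrow> 'b \<Rightarrow> bit" where
  "form f T s t = bil n (inv_into T f s) (inv_into T f t)"

context
  fixes f :: "(nat \<Rightarrow> bit) \<Rightarrow> 'b" and C T :: "(nat \<Rightarrow> bit) set" and S :: "('b, nat \<Rightarrow> nat) gmodule"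
  assumes f: "factor_map f C T S" and T: "inv_code T" and radical: "T \<inter> perp T = C"
begin

lemma form_eq:
  assumes "x \<in> T" "y \<in> T" shows "form f T (f x) (f y) = bil n x y"
proof -
  have rep: "inv_into T f (f x) \<in> T" "inv_into T f (f x) + x \<in> C" if "x \<in> T" for x
    using inv_into_into[OF imageI[OF that], of f] f_inv_into_f[OF imageI[OF that], of f]
      factor_map_eq[OF f T] that by auto
  let ?x = "inv_into T f (f x)" and ?y = "inv_into T f (f y)"
  have "bil n (?x + x) ?y = 0" "bil n (?y + y) x = 0"
    using rep[OF assms(1)] rep[OF assms(2)] radical assms(1) by (auto simp: perp_iff)
  then have "bil n ?x ?y = bil n x ?y" "bil n ?y x = bil n y x"
    by (simp_all add: bil_add_left bit_add_eq_0)
  then show ?thesis using bil_commute[of n] by (simp add: form_def)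
qed

lemma factor_map_cases:
  assumes "s \<in> carrier S" obtains x where "x \<in> T" "s = f x"
  using assms factor_mapD(1)[OF f] by blast

lemma form_commute: "form f T s t = form f T t s"
  unfolding form_def by (rule bil_commute)

lemma form_add:
  assumes "s \<in> carrier S" "s' \<in> carrier S" "t \<in> carrier S"
  shows "form f T (s \<oplus>\<^bsub>S\<^esub> s') t = form f T s t + form f T s' t"
proof -
  obtain x x' y where "x \<in> T" "s = f x" "x' \<in> T" "s' = f x'" "y \<in> T" "t = f y"
    using assms factor_map_cases by metis
  then show ?thesis
    using form_eq inv_codeD(3)[OF T] by (simp add: bil_add_left flip: factor_mapD(3)[OF f])
qed

lemma form_act:
  assumes "s \<in> carrier S" "t \<in> carrier S" "g \<in> G"
  shows "form f T (s \<cdot>\<^bsub>S\<^esub> g) (t \<cdot>\<^bsub>S\<^esub> g) = form f T s t"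
proof -
  obtain x y where "x \<in> T" "s = f x" "y \<in> T" "t = f y"
    using assms factor_map_cases by metis
  then show ?thesis
    using form_eq inv_codeD(4)[OF T] assms(3) bil_comp[OF G_permutes[OF assms(3)]]
    by (simp flip: factor_mapD(4)[OF f])
qed

lemma form_nondegenerate:
  assumes s: "s \<in> carrier S" "s' \<in> carrier S" and eq: "\<And>t. t \<in> carrier S \<Longrightarrow> form f T s t = form f T s' t"
  shows "s = s'"
proof -
  obtain x x' where x: "x \<in> T" "s = f x" "x' \<in> T" "s' = f x'"
    using s factor_map_cases by metis
  have "bil n (x + x') y = 0" if "y \<in> T" for y
    using eq[of "f y"] form_eq x that factor_mapD(9)[OF f] by (simp add: bil_add_left)
  then have "x + x' \<in> T \<inter> perp T"
    using inv_codeD(3)[OF T x(1,3)] inv_codeD(1)[OF T] perp_iff by blast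
  then show ?thesis using factor_map_eq[OF f T x(1,3)] x radical by simp
qed

text \<open>The pullback of \<open>\<phi>\<close> to \<open>T\<close> is represented by a vector
  \<open>v\<close>, which is orthogonal to \<open>C\<close> and so lies in
  \<open>perp C = T + perp T\<close>. Its component in \<open>T\<close> represents
  \<open>\<phi>\<close>.\<close>

lemma form_represents:
  assumes \<phi>: "\<And>s t. s \<in> carrier S \<Longrightarrow> t \<in> carrier S \<Longrightarrow> \<phi> (s \<oplus>\<^bsub>S\<^esub> t) = \<phi> s + \<phi> t"
  shows "\<exists>s\<in>carrier S. \<forall>t\<in>carrier S. form f T s t = \<phi> t"
proof -
  note fD = factor_mapD[OF f] and TD = inv_codeD[OF T]
  have PT: "inv_code (perp T)" by (rule inv_code_perp[OF T])
  have C: "inv_code C" using inv_code_inter[OF T PT] radical by simp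
  have sum: "csum T (perp T) = perp C"
  proof -
    have "perp (csum T (perp T)) = C"
      using perp_csum[OF T PT] perp_perp[OF T] radical by (simp add: Int_commute)
    then show ?thesis using perp_perp[OF inv_code_csum(1)[OF T PT]] by simp
  qed
  obtain v where v: "v \<in> V" "\<And>x. x \<in> T \<Longrightarrow> bil n v x = \<phi> (f x)"
    using functional_rep[OF T, of "\<lambda>x. \<phi> (f x)"] \<phi> fD(3,9) by auto
  have "\<phi> \<zero>\<^bsub>S\<^esub> = \<phi> \<zero>\<^bsub>S\<^esub> + \<phi> \<zero>\<^bsub>S\<^esub>"
    using \<phi>[of "f 0" "f 0"] fD(3)[OF TD(2) TD(2)] fD(2) fD(9)[OF TD(2)] by simp
  then have "\<phi> \<zero>\<^bsub>S\<^esub> = 0" by simp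
  then have "bil n v a = 0" if "a \<in> C" for a
    using v(2)[of a] fD(7)[of a] fD(8) that by auto
  then have "v \<in> csum T (perp T)" unfolding sum using v(1) perp_iff by blast
  then obtain t t' where t: "t \<in> T" "t' \<in> perp T" "v = t + t'" by (auto simp: csum_def)
  have "form f T (f t) s = \<phi> s" if "s \<in> carrier S" for s
  proof -
    obtain x where x: "x \<in> T" "s = f x" by (rule factor_map_cases[OF \<open>s \<in> carrier S\<close>])
    then have "bil n v x = bil n t x" using t by (simp add: bil_add_left perp_iff)
    then show ?thesis using x form_eq[OF t(1) x(1)] v(2)[OF x(1)] by simp
  qed
  then show ?thesis using fD(9)[OF t(1)] by blast
qed

end

section \<open>Existence of self-dual invariant codes\<close>

text \<open>The last conclusion makes \<open>U\<close> project onto \<open>T2\<close>, which later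
  shows that \<open>U\<close> is larger than \<open>C\<close>. Self-orthogonality holds because the
  contributions of \<open>T1\<close> and \<open>T2\<close> agree under the isometry and cancel in
  characteristic 2.\<close>

lemma glued_code:
  assumes f1: "factor_map f1 C T1 S" and f2: "factor_map f2 C T2 S"
    and T: "inv_code T1" "inv_code T2" and radical: "T1 \<inter> perp T1 = C" "T2 \<inter> perp T2 = C"
    and orth: "T2 \<subseteq> perp T1" and simple: "simple_gmodule GG S"
  obtains U where "inv_code U" "U \<subseteq> perp U" "C \<subseteq> U" "\<And>y. y \<in> T2 \<Longrightarrow> \<exists>x\<in>T1. x + y \<in> U"
proof -
  interpret S: F2G_module GG S using F2G_module_factor[OF f1 T(1)] .
  note D1 = factor_mapD[OF f1] and D2 = factor_mapD[OF f2]
  note T1 = inv_codeD[OF T(1)] and T2 = inv_codeD[OF T(2)]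
  note F1 = f1 T(1) radical(1) and F2 = f2 T(2) radical(2)
  define B1 where "B1 = form f1 T1"
  define B2 where "B2 = form f2 T2"
  note B_defs = B1_def B2_def
  have fin: "finite (carrier S)" using D1(1) T1(5) by (metis finite_imageI)
  \<comment> \<open>Nondegeneracy of \<open>B1\<close> expresses \<open>B2\<close> through it:
    \<open>\<alpha>\<close> will satisfy \<open>B1 (\<alpha> s) t = B2 s t\<close>.\<close>
  have "\<exists>s'\<in>carrier S. \<forall>t\<in>carrier S. B1 s' t = B2 s t" if s: "s \<in> carrier S" for s
    unfolding B_defs
    by (rule form_represents[OF F1])
      (simp add: form_commute[OF F2, of s] form_add[OF F2] s)
  then obtain \<alpha> where \<alpha>: "\<And>s. s \<in> carrier S \<Longrightarrow> \<alpha> s \<in> carrier S"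
    "\<And>s t. s \<in> carrier S \<Longrightarrow> t \<in> carrier S \<Longrightarrow> B1 (\<alpha> s) t = B2 s t" by metis
  have uniq: "\<And>s s'. s \<in> carrier S \<Longrightarrow> s' \<in> carrier S \<Longrightarrow>
      (\<And>t. t \<in> carrier S \<Longrightarrow> B1 s t = B1 s' t) \<Longrightarrow> s = s'"
    unfolding B_defs by (rule form_nondegenerate[OF F1])
  have \<alpha>_add: "\<alpha> (s \<oplus>\<^bsub>S\<^esub> s') = \<alpha> s \<oplus>\<^bsub>S\<^esub> \<alpha> s'" if "s \<in> carrier S" "s' \<in> carrier S" for s s'
    using \<alpha> that by (intro uniq) (simp_all add: form_add[OF F1, folded B1_def] form_add[OF F2, folded B2_def])
  have \<alpha>_act: "\<alpha> (s \<cdot>\<^bsub>S\<^esub> g) = \<alpha> s \<cdot>\<^bsub>S\<^esub> g" if s: "s \<in> carrier S" and g: "g \<in> carrier GG" for s g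
  proof (rule uniq)
    have g': "g \<in> G" using g by simp
    fix t assume t: "t \<in> carrier S"
    \<comment> \<open>Writing \<open>t\<close> as the image of \<open>u\<close> under
      \<open>g\<close> allows the invariance of both forms to be applied.\<close>
    define u where "u = t \<cdot>\<^bsub>S\<^esub> inv\<^bsub>GG\<^esub> g"
    have u: "u \<in> carrier S" "t = u \<cdot>\<^bsub>S\<^esub> g"
      using t g inv_in_G[OF g'] S.act_closed S.act_mult[OF t, of "inv\<^bsub>GG\<^esub> g" g] S.act_one[OF t]
      by (simp_all add: u_def)
    show "B1 (\<alpha> (s \<cdot>\<^bsub>S\<^esub> g)) t = B1 (\<alpha> s \<cdot>\<^bsub>S\<^esub> g) t"
      using s g g' u \<alpha> S.act_closed
      by (simp add: form_act[OF F1, folded B1_def] form_act[OF F2, folded B2_def])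
  qed (use s g \<alpha> S.act_closed in auto)
  have \<alpha>_inj: "inj_on \<alpha> (carrier S)"
  proof
    fix s s' assume s: "s \<in> carrier S" "s' \<in> carrier S" and eq: "\<alpha> s = \<alpha> s'"
    have "B2 s t = B2 s' t" if "t \<in> carrier S" for t using \<alpha>(2)[OF s(1) that] \<alpha>(2)[OF s(2) that] eq by simp
    then show "s = s'" using form_nondegenerate[OF F2 s] by (simp add: B2_def)
  qed
  obtain k where k: "\<And>s. s \<in> carrier S \<Longrightarrow> (\<alpha> ^^ k) ((\<alpha> ^^ k) s) = \<alpha> s"
    using S.simple_endomorphism_square_root[OF simple fin \<alpha>(1) \<alpha>_add \<alpha>_act \<alpha>_inj] by metis
  define \<beta> where "\<beta> = \<alpha> ^^ k"
  have pow: "(\<alpha> ^^ m) s \<in> carrier S" if "s \<in> carrier S" for m s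
    by (induction m) (auto simp: that \<alpha>(1))
  \<comment> \<open>Both forms are symmetric, so \<open>\<alpha>\<close> is self-adjoint for
    \<open>B1\<close>, and so are its powers.\<close>
  have \<alpha>_adj: "B1 (\<alpha> s) t = B1 s (\<alpha> t)" if "s \<in> carrier S" "t \<in> carrier S" for s t
    using \<alpha> that form_commute[OF F1] form_commute[OF F2] unfolding B_defs by metis
  have "B1 ((\<alpha> ^^ m) s) t = B1 s ((\<alpha> ^^ m) t)" if "s \<in> carrier S" "t \<in> carrier S" for m s t
    using that
  proof (induction m arbitrary: t)
    case (Suc m)
    have "B1 ((\<alpha> ^^ Suc m) s) t = B1 ((\<alpha> ^^ m) s) (\<alpha> t)"
      using \<alpha>_adj pow Suc.prems by simp
    also have "\<dots> = B1 s ((\<alpha> ^^ m) (\<alpha> t))" using Suc.IH Suc.prems \<alpha>(1) by blast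
    also have "(\<alpha> ^^ m) (\<alpha> t) = (\<alpha> ^^ Suc m) t" by (simp add: funpow_swap1)
    finally show ?case .
  qed simp
  \<comment> \<open>One \<open>\<beta>\<close> moves across \<open>B1\<close> by adjointness, giving
    \<open>B1 (\<beta> (\<beta> s)) t = B1 (\<alpha> s) t = B2 s t\<close>.\<close>
  then have isometry: "B1 (\<beta> s) (\<beta> t) = B2 s t" if "s \<in> carrier S" "t \<in> carrier S" for s t
    using that k[OF that(1)] \<alpha>(2)[OF that] pow unfolding \<beta>_def by metis
  have \<beta>: "\<beta> s \<in> carrier S" if "s \<in> carrier S" for s using pow that by (simp add: \<beta>_def)
  have \<beta>_add: "\<beta> (s \<oplus>\<^bsub>S\<^esub> s') = \<beta> s \<oplus>\<^bsub>S\<^esub> \<beta> s'" if "s \<in> carrier S" "s' \<in> carrier S" for s s'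
    unfolding \<beta>_def by (induction k) (auto simp: that \<alpha>_add pow)
  have \<beta>_act: "\<beta> (s \<cdot>\<^bsub>S\<^esub> g) = \<beta> s \<cdot>\<^bsub>S\<^esub> g" if "s \<in> carrier S" "g \<in> G" for s g
    unfolding \<beta>_def by (induction k) (use that \<alpha>_act pow in auto)
  have \<beta>0: "\<beta> \<zero>\<^bsub>S\<^esub> = \<zero>\<^bsub>S\<^esub>"
    using \<beta>_add[of "\<zero>\<^bsub>S\<^esub>" "\<zero>\<^bsub>S\<^esub>"] S.add_self[of "\<beta> \<zero>\<^bsub>S\<^esub>"] \<beta>[of "\<zero>\<^bsub>S\<^esub>"] by simp
  \<comment> \<open>The preimage in \<open>T1 + T2\<close> of the graph of
    \<open>\<beta>\<close>.\<close>
  define U where "U = {x + y | x y. x \<in> T1 \<and> y \<in> T2 \<and> f1 x = \<beta> (f2 y)}"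
  have UI: "x + y \<in> U" if "x \<in> T1" "y \<in> T2" "f1 x = \<beta> (f2 y)" for x y
    using that by (auto simp: U_def)
  show ?thesis
  proof (rule that)
    have V: "U \<subseteq> V"
      using T1(1) T2(1) inv_codeD(3)[OF inv_code_V] unfolding U_def by blast
    show "inv_code U"
      unfolding inv_code_def
    proof (intro conjI ballI)
      show "0 \<in> U" using UI[OF T1(2) T2(2)] D1(2) D2(2) \<beta>0 by simp
    next
      fix z w assume "z \<in> U" "w \<in> U"
      then obtain x y x' y' where z: "z = x + y" "x \<in> T1" "y \<in> T2" "f1 x = \<beta> (f2 y)"
        and w: "w = x' + y'" "x' \<in> T1" "y' \<in> T2" "f1 x' = \<beta> (f2 y')" unfolding U_def by blast
      have "z + w = (x + x') + (y + y')" using z w by (simp add: algebra_simps)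
      moreover have "(x + x') + (y + y') \<in> U"
        using z w D1(3) D2(3,9) \<beta>_add T1(3) T2(3) by (intro UI) simp_all
      ultimately show "z + w \<in> U" by simp
    next
      fix z g assume g: "g \<in> G" and "z \<in> U"
      then obtain x y where z: "z = x + y" "x \<in> T1" "y \<in> T2" "f1 x = \<beta> (f2 y)" unfolding U_def by blast
      have "(x \<circ> g) + (y \<circ> g) \<in> U"
        using z g D1(4) D2(4,9) \<beta>_act T1(4) T2(4) by (intro UI) simp_all
      then show "z \<circ> g \<in> U" using z by (simp add: comp_add)
    qed (rule V)
    show "U \<subseteq> perp U"
    proof
      fix z assume zU: "z \<in> U"
      then obtain x y where z: "z = x + y" "x \<in> T1" "y \<in> T2" "f1 x = \<beta> (f2 y)" unfolding U_def by blast
      have "bil n z w = 0" if "w \<in> U" for w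
      proof -
        obtain x' y' where w: "w = x' + y'" "x' \<in> T1" "y' \<in> T2" "f1 x' = \<beta> (f2 y')"
          using \<open>w \<in> U\<close> unfolding U_def by blast
        have "bil n x x' = bil n y y'"
          using isometry[OF D2(9)[OF z(3)] D2(9)[OF w(3)]] form_eq[OF F1 z(2) w(2)] form_eq[OF F2 z(3) w(3)] z w
          by (simp add: B_defs)
        moreover have "bil n y x' = 0" "bil n y' x = 0"
          using orth z w by (auto simp: perp_iff)
        moreover have "bil n x y' = bil n y' x" by (rule bil_commute)
        ultimately show ?thesis using z w by (simp add: bil_add_left bil_add_right)
      qed
      then show "z \<in> perp U" using V zU perp_iff by blast
    qed
    show "C \<subseteq> U"
    proof
      fix c assume c: "c \<in> C"
      then have "c \<in> T1" using D1(8) by blast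
      then have "c + 0 \<in> U"
        using UI[of c 0] D1(7)[of c] D2(2) T2(2) \<beta>0 c by simp
      then show "c \<in> U" by simp
    qed
    fix y assume y: "y \<in> T2"
    then obtain x where "x \<in> T1" "\<beta> (f2 y) = f1 x"
      using factor_map_cases[OF F1 \<beta>[OF D2(9)[OF y]]] by metis
    then show "\<exists>x\<in>T1. x + y \<in> U" using UI[of x y] y by (intro bexI[of _ x]) simp_all
  qed
qed

lemma self_dual_code_ex_iff:
  "(\<exists>C. self_dual_code n C \<and> G \<subseteq> Aut_code n C) \<longleftrightarrow>
    (\<forall>S :: ('a::infinite, nat \<Rightarrow> nat) gmodule. simple_gmodule GG S \<and> self_dual_gmodule GG S \<longrightarrow>
       even (factor_multiplicity GG (F2_space n) S))" (is "?L \<longleftrightarrow> ?R")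
proof
  assume ?L
  then obtain C where C: "self_dual_code n C" "G \<subseteq> Aut_code n C" by blast
  note C = self_dual_code_inv_code[OF C]
  show ?R
  proof (intro allI impI)
    fix S :: "('a, nat \<Rightarrow> nat) gmodule"
    assume S: "simple_gmodule GG S \<and> self_dual_gmodule GG S"
    then have M: "F2G_module GG S" by (simp add: simple_gmodule_def)
    have "mult_in S V = 2 * mult_in S C"
      using mult_in_perp[OF M _ C(1)] S C(2) by simp
    then show "even (factor_multiplicity GG (F2_space n) S)"
      by (simp add: factor_multiplicity_eq[OF M])
  qed
next
  assume even: ?R
  let ?F = "{N. inv_code N \<and> N \<subseteq> perp N}"
  have "finite ?F" using finite_inv_codes by simp
  moreover have "{0} \<in> ?F" using inv_code_zero inv_codeD(2)[OF inv_code_V] by (simp add: perp_zero)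
  ultimately have "\<exists>C\<in>?F. \<forall>N\<in>?F. C \<subseteq> N \<longrightarrow> C = N"
    by (intro finite_has_maximal) blast+
  then obtain C where C: "C \<in> ?F" and max: "\<forall>N\<in>?F. C \<subseteq> N \<longrightarrow> C = N" by (rule bexE)
  have C: "inv_code C" "C \<subseteq> perp C" using C by simp_all
  note PC = inv_code_perp[OF C(1)]
  have max: "N = C" if "inv_code N" "N \<subseteq> perp N" "C \<subseteq> N" for N
    using max that by blast
  \<comment> \<open>\<open>X \<inter> perp X\<close> is a self-orthogonal invariant code containing
    \<open>C\<close>, so maximality applies to it.\<close>
  have anisotropic: "X \<inter> perp X = C" if X: "inv_code X" "C \<subseteq> X" "X \<subseteq> perp C" for X
  proof (rule max)
    show "inv_code (X \<inter> perp X)" using inv_code_inter[OF X(1) inv_code_perp[OF X(1)]] .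
    have "perp X \<subseteq> perp (X \<inter> perp X)" by (rule perp_antimono) simp
    then show "X \<inter> perp X \<subseteq> perp (X \<inter> perp X)" by blast
    show "C \<subseteq> X \<inter> perp X" using X(2) perp_antimono[OF X(3)] perp_perp[OF C(1)] by blast
  qed
  \<comment> \<open>Taking complements in \<open>anisotropic\<close> shows that \<open>X/C\<close>
    is an orthogonal direct summand of \<open>perp C/C\<close>.\<close>
  have split: "csum X (perp X) = perp C" if X: "inv_code X" "C \<subseteq> X" "X \<subseteq> perp C" for X
  proof -
    note P = inv_code_perp[OF X(1)]
    have "perp (csum X (perp X)) = C"
      using perp_csum[OF X(1) P] perp_perp[OF X(1)] anisotropic[OF X] by (simp add: Int_commute)
    then show ?thesis using perp_perp[OF inv_code_csum(1)[OF X(1) P]] by simp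
  qed
  have "perp C = C"
  proof (rule ccontr)
    assume "perp C \<noteq> C"
    then have "C \<subset> perp C" using C(2) by blast
    then obtain T1 where T1: "T1 \<subseteq> perp C" "covers C T1" using covers_above_ex[OF PC C(1)] by blast
    note c1 = coversD[OF T1(2)] and PT1 = inv_code_perp[OF coversD(2)[OF T1(2)]]
    have CT1: "C \<subseteq> T1" using c1(3) by blast
    note an1 = anisotropic[OF c1(2) CT1 T1(1)] and sp1 = split[OF c1(2) CT1 T1(1)]
    obtain S :: "('a, nat \<Rightarrow> nat) gmodule" where S: "simple_gmodule GG S" "factor C T1 S"
      by (rule simple_factor_copy[OF T1(2)])
    \<comment> \<open>The complement of \<open>T1/C\<close> makes \<open>perp C/perp T1\<close>
      isomorphic to \<open>T1/C\<close>, that is to \<open>S\<close>; by \<open>factor_perp\<close>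
      it is also the dual of \<open>S\<close>. So \<open>S\<close> is self-dual.\<close>
    have "factor (perp T1) (perp C) S"
      using factor_csum_iff[OF c1(2) PT1, of S] S(2) by (simp add: an1 sp1)
    then have sd: "self_dual_gmodule GG S"
      using factor_iso[OF _ factor_perp[OF S(2) c1(1,2)] PC] by (simp add: self_dual_gmodule_def)
    have M: "F2G_module GG S" using S(1) by (simp add: simple_gmodule_def)
    \<comment> \<open>If \<open>S\<close> did not occur in \<open>perp T1/C\<close>, its
      multiplicity in \<open>perp C\<close> would exceed that in \<open>C\<close> by one, and by
      \<open>mult_in_perp\<close> its multiplicity in \<open>V\<close> would be odd.\<close>
    have ne: "mult_in S (perp T1) \<noteq> mult_in S C"
    proof
      assume eq: "mult_in S (perp T1) = mult_in S C"
      have "mult_in S (perp C) = mult_in S (perp T1) + 1"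
        using mult_in_covers[OF covers_perp[OF T1(2)], of S] \<open>factor (perp T1) (perp C) S\<close> by simp
      then have "mult_in S V = 2 * mult_in S C + 1"
        using mult_in_perp[OF M sd C(1)] eq by simp
      moreover have "even (mult_in S V)"
        using even S(1) sd factor_multiplicity_eq[OF M] by metis
      ultimately show False by simp
    qed
    \<comment> \<open>A composition factor of \<open>X/C\<close> is a submodule of it, since simple submodules split off.\<close>
    have find: "\<exists>T. T \<subseteq> X \<and> covers C T \<and> factor C T S"
      if "inv_code X" "C \<subseteq> X" "X \<subseteq> perp C" "mult_in S X \<noteq> mult_in S C" for X
      using that
    proof (induction "card X" arbitrary: X rule: less_induct)
      case less
      note X = less.prems
      have "C \<subset> X" using X by blast
      then obtain T where T: "T \<subseteq> X" "covers C T" using covers_above_ex[OF X(1) C(1)] by blast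
      note c = coversD[OF T(2)]
      show ?case
      proof (cases "factor C T S")
        case True then show ?thesis using T by blast
      next
        case False
        have CT: "C \<subseteq> T" "T \<subseteq> perp C" using c(3) T(1) X(3) by auto
        note PT = inv_code_perp[OF c(2)]
        \<comment> \<open>The orthogonal complement of \<open>T\<close> in \<open>X\<close>. Since
          \<open>X/X'\<close> is isomorphic to \<open>T/C\<close>, which is not \<open>S\<close>,
          the search continues in \<open>X'\<close> with the same multiplicity.\<close>
        define X' where "X' = perp T \<inter> X"
        have X': "inv_code X'" unfolding X'_def by (rule inv_code_inter[OF PT X(1)])
        have inter: "T \<inter> X' = C" using anisotropic[OF c(2) CT] T(1) by (auto simp: X'_def)
        have sum: "csum T X' = X"
        proof
          show "csum T X' \<subseteq> X" using csum_least[OF X(1) T(1)] by (simp add: X'_def)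
          show "X \<subseteq> csum T X'"
          proof
            fix x assume x: "x \<in> X"
            then have "x \<in> csum T (perp T)" using split[OF c(2) CT] X(3) by blast
            then obtain t t' where t: "t \<in> T" "t' \<in> perp T" "x = t + t'" by (auto simp: csum_def)
            then have "t' \<in> X" using inv_code_cancel[OF X(1), of t t'] T(1) x by blast
            then show "x \<in> csum T X'" using t csumI by (simp add: X'_def)
          qed
        qed
        have cov: "covers X' X" using covers_csum_iff[OF c(2) X'] T(2) by (simp add: sum inter)
        have "\<not> factor X' X S" using factor_csum_iff[OF c(2) X', of S] False by (simp add: sum inter)
        then have "mult_in S X' = mult_in S X" using mult_in_covers[OF cov, of S] by simp
        moreover have "card X' < card X"
          using coversD(3)[OF cov] inv_codeD(5)[OF X(1)] by (simp add: psubset_card_mono)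
        moreover have "C \<subseteq> X'" "X' \<subseteq> perp C" using inter X(3) by (auto simp: X'_def)
        ultimately obtain T' where "T' \<subseteq> X'" "covers C T'" "factor C T' S"
          using less.hyps[OF _ X'] X(4) by metis
        then show ?thesis by (auto simp: X'_def)
      qed
    qed
    have "C \<subseteq> perp T1" "perp T1 \<subseteq> perp C" using an1 CT1 perp_antimono by auto
    then obtain T2 where T2: "T2 \<subseteq> perp T1" "covers C T2" "factor C T2 S"
      using find[OF PT1 _ _ ne] by blast
    note c2 = coversD[OF T2(2)]
    have "T2 \<inter> perp T2 = C"
      by (rule anisotropic[OF c2(2)]) (use c2(3) T2(1) \<open>perp T1 \<subseteq> perp C\<close> in auto)
    then obtain U where U: "inv_code U" "U \<subseteq> perp U" "C \<subseteq> U" "\<And>y. y \<in> T2 \<Longrightarrow> \<exists>x\<in>T1. x + y \<in> U"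
      using S(2) T2(3) glued_code[OF _ _ c1(2) c2(2) an1 _ T2(1) S(1)] unfolding factor_def by metis
    have "U = C" using max U by blast
    \<comment> \<open>\<open>U = C\<close> lies in \<open>T1\<close>, so \<open>x + y\<close> in
      \<open>U\<close> puts \<open>y\<close> into \<open>T1\<close>. As \<open>y\<close> is also in
      \<open>perp T1\<close>, it lies in \<open>C\<close>, contrary to its choice.\<close>
    obtain y where y: "y \<in> T2" "y \<notin> C" using c2(3) by blast
    then obtain x where "x \<in> T1" "x + y \<in> T1" using U(4) \<open>U = C\<close> CT1 by blast
    then have "y \<in> T1" using inv_code_cancel[OF c1(2)] by blast
    then show False using y T2(1) an1 by blast
  qed
  then show ?L using self_dual_codeI C(1) by blast
qed

end

theorem theorem2p3:
  fixes n :: nat and G :: "(nat \<Rightarrow> nat) set"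
  assumes "subgroup G (sym_group n)"
  shows "(\<exists>C. self_dual_code n C \<and> G \<subseteq> Aut_code n C) \<longleftrightarrow>
    (\<forall>S :: ('a::infinite, nat \<Rightarrow> nat) gmodule.
       simple_gmodule (sym_group n\<lparr>carrier := G\<rparr>) S \<and>
       self_dual_gmodule (sym_group n\<lparr>carrier := G\<rparr>) S \<longrightarrow>
       even (factor_multiplicity (sym_group n\<lparr>carrier := G\<rparr>) (F2_space n) S))"
  by (rule perm_group.self_dual_code_ex_iff) (simp add: perm_group_def assms)

end
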